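(* Let $S$ be a cancellative and right amenable monoid, $G=S^{-1}S$ its group of left fractions, and $\lambda$ a left $S$-action on a discrete Abelian group $X$. Let $\lambda^*$, a left $G$-action on the Abelian group $X^*$, be the (left) Ore localization of $\lambda$. Then $h_{\mathrm{alg}}(\lambda)=h_{\mathrm{alg}}(\lambda^* )$.
   Context: A cancellative monoid $S$ is right amenable if it admits a right F{\o}lner net, i.e. a net $\{F_i\}_{i\in I}$ of non-empty finite subsets of $S$ such that $\lim_{i\in I}|F_is\setminus F_i|/|F_i|=0$ for every $s\in S$. Such an $S$ satisfies the left Ore condition ($Ss\cap St\ne\emptyset$ for all $s,t\in S$) and so embeds in its group of left fractions $G=S^{-1}S$, in which every element has the form $s^{-1}t$ with $s,t\in S$; $G$ is amenable. A left $S$-action $\lambda$ on an Abelian group $X$ is a family of endomorphisms $\lambda_s$ with $\lambda_1=\mathrm{id}_X$, $\lambda_{st}=\lambda_s\circ\lambda_t$ (similarly for $G$). Ore localization: $\mathrm{Ker}(\lambda)=\bigcup_{s\in S}\mathrm{Ker}(\lambda_s)$ is an $S$-invariant subgroup of $X$; let $\bar X=X/\mathrm{Ker}(\lambda)$ with the induced left $S$-action $\bar\lambda$. Preorder $G$ by $g_1\le_S g_2$ iff $g_2^{-1}g_1\in S$; this is directed. Let $X^*$ be the direct limit of the direct system indexed by $(G,\le_S)$ with $X_g=\bar X$ for all $g\in G$ and transition maps $\bar\lambda_s\colon X_{gs}\to X_g$ ($g\in G$, $s\in S$), and let $\varepsilon_g\colon\bar X=X_g\to X^*$ be the canonical maps.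 Then $\lambda^*$ is the unique left $G$-action on $X^*$ such that $\lambda^*_g\circ\varepsilon_h=\varepsilon_{gh}$ for all $g,h\in G$. Algebraic entropy (for $M=S$ or $M=G$ acting on the left on an Abelian group $A$ via $\alpha$): for a finite $E\subseteq A$ containing $0$ and a non-empty finite $F\subseteq M$ let $T_F(\alpha,E)=\sum_{s\in F}\alpha_s(E)$. For a right F{\o}lner net $\{F_i\}$ of $M$ put $H_{\mathrm{alg}}(\alpha,E)=\lim_i\frac{\log|T_{F_i}(\alpha,E)|}{|F_i|}$ (the limit exists and does not depend on the net), and $h_{\mathrm{alg}}(\alpha)=\sup_E H_{\mathrm{alg}}(\alpha,E)\in[0,\infty]$ over all finite $E\subseteq A$ with $0\in E$. *)

theory Defs
  imports "HOL-Analysis.Analysis" "HOL-Algebra.Algebra"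
begin

section \<open>Nets\<close>

definition directed_preorder :: "'i set \<Rightarrow> 'i rel \<Rightarrow> bool" where
  "directed_preorder I r \<longleftrightarrow> I \<noteq> {} \<and> preorder_on I r \<and>
     (\<forall>i\<in>I. \<forall>j\<in>I. \<exists>k\<in>I. (i, k) \<in> r \<and> (j, k) \<in> r)"

text \<open>
  The filter generated by the tails of a directed set. Convergence of a net \<open>f\<close> indexed by
  \<open>(I, r)\<close> to \<open>l\<close> is \<open>(f \<longlongrightarrow> l) (tails I r)\<close>.
\<close>

definition tails :: "'i set \<Rightarrow> 'i rel \<Rightarrow> 'i filter" where
  "tails I r = (INF i\<in>I. principal {j \<in> I. (i, j) \<in> r})"

lemma eventually_tails:
  assumes "directed_preorder I r"
  shows "eventually P (tails I r) \<longleftrightarrow> (\<exists>i\<in>I. \<forall>j\<in>I. (i, j) \<in> r \<longrightarrow> P j)"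
proof -
  from assms have ne: "I \<noteq> {}" and tr: "trans r"
    and dir: "\<And>i j. i \<in> I \<Longrightarrow> j \<in> I \<Longrightarrow> \<exists>k\<in>I. (i, k) \<in> r \<and> (j, k) \<in> r"
    by (auto simp: directed_preorder_def preorder_on_def)
  have "eventually P (tails I r) \<longleftrightarrow>
      (\<exists>i\<in>I. eventually P (principal {j \<in> I. (i, j) \<in> r}))"
    unfolding tails_def
  proof (rule eventually_INF_base[OF ne])
    fix a b assume "a \<in> I" "b \<in> I"
    then obtain k where k: "k \<in> I" "(a, k) \<in> r" "(b, k) \<in> r" using dir by blast
    have "{j \<in> I. (k, j) \<in> r} \<subseteq> {j \<in> I. (a, j) \<in> r} \<inter> {j \<in> I. (b, j) \<in> r}"
      using k tr by (blast dest: transD)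
    then show "\<exists>x\<in>I. principal {j \<in> I. (x, j) \<in> r}
        \<le> inf (principal {j \<in> I. (a, j) \<in> r}) (principal {j \<in> I. (b, j) \<in> r})"
      using k(1) by (intro bexI[of _ k]) simp_all
  qed
  then show ?thesis by (auto simp: eventually_principal)
qed

lemma tails_neq_bot: "directed_preorder I r \<Longrightarrow> tails I r \<noteq> bot"
  by (auto simp: trivial_limit_def eventually_tails directed_preorder_def preorder_on_def refl_on_def)


section \<open>Amenability\<close>

definition right_folner_net ::
    "('m, 'b) monoid_scheme \<Rightarrow> 'i set \<Rightarrow> 'i rel \<Rightarrow> ('i \<Rightarrow> 'm set) \<Rightarrow> bool" where
  "right_folner_net M I r F \<longleftrightarrow>
     directed_preorder I r \<and>
     (\<forall>i\<in>I. finite (F i) \<and> F i \<noteq> {} \<and> F i \<subseteq> carrier M) \<and>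
     (\<forall>s\<in>carrier M.
        ((\<lambda>i. real (card ((\<lambda>f. f \<otimes>\<^bsub>M\<^esub> s) ` F i - F i)) / real (card (F i))) \<longlongrightarrow> 0)
          (tails I r))"

text \<open>
  A definition cannot quantify over the type of the indices of a net, so quantification over nets
  of subsets of \<open>'m\<close> is over those indexed by a directed subset of the following type. Up to the
  filter which a net generates, and hence up to convergence of functions of the net, these are all
  the nets: see \<open>right_folner_net_reindex\<close>.
\<close>

type_synonym 'm net_index = "'m set set \<times> 'm set"

lemma right_folner_net_reindex:
  fixes I :: "'i set" and F :: "'i \<Rightarrow> 'm set"
  assumes N: "right_folner_net M I r F"
  shows "\<exists>(I' :: 'm net_index set) r' F'. right_folner_net M I' r' F' \<and>
    filtermap F' (tails I' r') = filtermap F (tails I r)"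
proof -
  define \<Phi> where "\<Phi> = filtermap F (tails I r)"
  define J where "J = {(P, A). eventually (\<lambda>B. B \<in> P) \<Phi> \<and> A \<in> P \<and> A \<in> F ` I}"
  define q where "q = {(a, b). a \<in> J \<and> b \<in> J \<and> fst b \<subseteq> fst a}"
  have D: "directed_preorder I r" using N by (simp add: right_folner_net_def)
  have nb: "\<Phi> \<noteq> bot" unfolding \<Phi>_def using tails_neq_bot[OF D] by (simp add: filtermap_bot_iff)
  have im: "eventually (\<lambda>B. B \<in> F ` I) \<Phi>"
    unfolding \<Phi>_def eventually_filtermap eventually_tails[OF D]
    using D by (auto simp: directed_preorder_def)
  have ex: "\<exists>A. (P, A) \<in> J" if "eventually (\<lambda>B. B \<in> P) \<Phi>" for P
  proof -
    from that im have "eventually (\<lambda>B. B \<in> P \<and> B \<in> F ` I) \<Phi>" by (rule eventually_conj)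
    then obtain A where "A \<in> P \<and> A \<in> F ` I" using nb eventually_happens' by blast
    then show ?thesis using that by (auto simp: J_def)
  qed
  have DJ: "directed_preorder J q"
    unfolding directed_preorder_def preorder_on_def
  proof (intro conjI ballI)
    show "J \<noteq> {}" using ex[OF im] by auto
    show "q \<subseteq> J \<times> J" "refl_on J q" "trans q" by (auto simp: q_def refl_on_def trans_def)
    fix a b assume ab: "a \<in> J" "b \<in> J"
    then have "eventually (\<lambda>B. B \<in> fst a \<inter> fst b) \<Phi>"
      by (auto simp: J_def eventually_conj_iff)
    then obtain A where "(fst a \<inter> fst b, A) \<in> J" using ex by blast
    then show "\<exists>k\<in>J. (a, k) \<in> q \<and> (b, k) \<in> q" using ab
      by (intro bexI[of _ "(fst a \<inter> fst b, A)"]) (auto simp: q_def)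
  qed
  have eq: "filtermap snd (tails J q) = \<Phi>"
    unfolding filter_eq_iff eventually_filtermap eventually_tails[OF DJ]
  proof (intro allI iffI)
    fix P assume "\<exists>i\<in>J. \<forall>j\<in>J. (i, j) \<in> q \<longrightarrow> P (snd j)"
    then obtain i where i: "i \<in> J" "\<forall>j\<in>J. (i, j) \<in> q \<longrightarrow> P (snd j)" by blast
    have 1: "eventually (\<lambda>B. B \<in> fst i) \<Phi>" using i by (auto simp: J_def)
    from 1 im show "eventually P \<Phi>"
    proof eventually_elim
      case (elim B)
      then have "(fst i, B) \<in> J" using 1 by (auto simp: J_def)
      then show ?case using i by (force simp: q_def)
    qed
  next
    fix P assume "eventually P \<Phi>"
    then have "eventually (\<lambda>B. B \<in> Collect P) \<Phi>" by simp
    then obtain A where A: "(Collect P, A) \<in> J" using ex by blast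
    show "\<exists>i\<in>J. \<forall>j\<in>J. (i, j) \<in> q \<longrightarrow> P (snd j)"
      by (rule bexI[OF _ A]) (auto simp: q_def J_def)
  qed
  have tr: "((\<lambda>j. f (snd j)) \<longlongrightarrow> l) (tails J q) \<longleftrightarrow> ((\<lambda>i. f (F i)) \<longlongrightarrow> l) (tails I r)"
    for f :: "'m set \<Rightarrow> real" and l
    using arg_cong[OF eq, of "\<lambda>\<Psi>. (f \<longlongrightarrow> l) \<Psi>"] by (simp add: \<Phi>_def filterlim_filtermap)
  have "right_folner_net M J q snd"
    unfolding right_folner_net_def
  proof (intro conjI ballI DJ)
    fix j assume "j \<in> J"
    then have "snd j \<in> F ` I" by (auto simp: J_def)
    then show "finite (snd j)" "snd j \<noteq> {}" "snd j \<subseteq> carrier M"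
      using N by (auto simp: right_folner_net_def)
  next
    fix s assume "s \<in> carrier M"
    then show "((\<lambda>j. real (card ((\<lambda>f. f \<otimes>\<^bsub>M\<^esub> s) ` snd j - snd j)) / real (card (snd j))) \<longlongrightarrow> 0) (tails J q)"
      using N tr[of "\<lambda>A. real (card ((\<lambda>f. f \<otimes>\<^bsub>M\<^esub> s) ` A - A)) / real (card A)" 0]
      by (simp add: right_folner_net_def)
  qed
  then show ?thesis using eq unfolding \<Phi>_def by blast
qed

definition right_amenable :: "('m, 'b) monoid_scheme \<Rightarrow> bool" where
  "right_amenable M \<longleftrightarrow> (\<exists>(I :: 'm net_index set) r F. right_folner_net M I r F)"

lemma right_amenableI: "right_folner_net M I r F \<Longrightarrow> right_amenable M"
  unfolding right_amenable_def using right_folner_net_reindex by blast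


section \<open>Actions and algebraic entropy\<close>

text \<open>
  Abelian groups are written multiplicatively, as \<^const>\<open>comm_group\<close>: the sum of a finite family
  is \<^const>\<open>finprod\<close> and the zero element is \<open>\<one>\<close>.
\<close>

definition left_action ::
    "('m, 'b) monoid_scheme \<Rightarrow> ('a, 'c) monoid_scheme \<Rightarrow> ('m \<Rightarrow> 'a \<Rightarrow> 'a) \<Rightarrow> bool" where
  "left_action M A \<alpha> \<longleftrightarrow>
     (\<forall>s\<in>carrier M. \<alpha> s \<in> hom A A) \<and>
     (\<forall>x\<in>carrier A. \<alpha> \<one>\<^bsub>M\<^esub> x = x) \<and>
     (\<forall>s\<in>carrier M. \<forall>t\<in>carrier M. \<forall>x\<in>carrier A. \<alpha> (s \<otimes>\<^bsub>M\<^esub> t) x = \<alpha> s (\<alpha> t x))"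

text \<open>The sum of sets \<open>\<Sum>s\<in>F. \<alpha>\<^sub>s(E)\<close>: an element is \<open>\<Sum>s\<in>F. \<alpha>\<^sub>s(e\<^sub>s)\<close> with all \<open>e\<^sub>s \<in> E\<close>.\<close>

definition trajectory ::
    "('a, 'c) monoid_scheme \<Rightarrow> ('m \<Rightarrow> 'a \<Rightarrow> 'a) \<Rightarrow> 'm set \<Rightarrow> 'a set \<Rightarrow> 'a set" where
  "trajectory A \<alpha> F E = {finprod A (\<lambda>s. \<alpha> s (e s)) F | e. e \<in> F \<rightarrow> E}"

definition H_alg ::
    "('m, 'b) monoid_scheme \<Rightarrow> ('a, 'c) monoid_scheme \<Rightarrow> ('m \<Rightarrow> 'a \<Rightarrow> 'a) \<Rightarrow> 'a set \<Rightarrow> real" where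
  "H_alg M A \<alpha> E =
     (THE h. \<forall>(I :: 'm net_index set) r F. right_folner_net M I r F \<longrightarrow>
        ((\<lambda>i. ln (real (card (trajectory A \<alpha> (F i) E))) / real (card (F i))) \<longlongrightarrow> h) (tails I r))"

definition h_alg ::
    "('m, 'b) monoid_scheme \<Rightarrow> ('a, 'c) monoid_scheme \<Rightarrow> ('m \<Rightarrow> 'a \<Rightarrow> 'a) \<Rightarrow> ereal" where
  "h_alg M A \<alpha> =
     (SUP E \<in> {E. finite E \<and> E \<subseteq> carrier A \<and> \<one>\<^bsub>A\<^esub> \<in> E}. ereal (H_alg M A \<alpha> E))"


section \<open>Groups of left fractions\<close>

definition group_of_left_fractions ::
    "('s, 'b) monoid_scheme \<Rightarrow> ('g, 'c) monoid_scheme \<Rightarrow> ('s \<Rightarrow> 'g) \<Rightarrow> bool" where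
  "group_of_left_fractions S G \<iota> \<longleftrightarrow>
     group G \<and> \<iota> \<in> hom S G \<and> \<iota> \<one>\<^bsub>S\<^esub> = \<one>\<^bsub>G\<^esub> \<and> inj_on \<iota> (carrier S) \<and>
     (\<forall>g\<in>carrier G. \<exists>s\<in>carrier S. \<exists>t\<in>carrier S. g = inv\<^bsub>G\<^esub> (\<iota> s) \<otimes>\<^bsub>G\<^esub> \<iota> t)"


section \<open>Direct limits\<close>

text \<open>
  The direct limit of groups \<open>A i\<close> with transition maps \<open>\<phi> i j\<close> for \<open>(i, j) \<in> r\<close>: the disjoint
  union of the \<open>A i\<close>, in which elements are identified when they eventually agree.
\<close>

definition dirlim_rel ::
    "'i set \<Rightarrow> 'i rel \<Rightarrow> ('i \<Rightarrow> ('a, 'c) monoid_scheme) \<Rightarrow> ('i \<Rightarrow> 'i \<Rightarrow> 'a \<Rightarrow> 'a) \<Rightarrow> ('i \<times> 'a) rel"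
  where
  "dirlim_rel I r A \<phi> =
     {((i, x), (j, y)). i \<in> I \<and> x \<in> carrier (A i) \<and> j \<in> I \<and> y \<in> carrier (A j) \<and>
        (\<exists>k\<in>I. (i, k) \<in> r \<and> (j, k) \<in> r \<and> \<phi> i k x = \<phi> j k y)}"

definition dirlim_map ::
    "'i set \<Rightarrow> 'i rel \<Rightarrow> ('i \<Rightarrow> ('a, 'c) monoid_scheme) \<Rightarrow> ('i \<Rightarrow> 'i \<Rightarrow> 'a \<Rightarrow> 'a) \<Rightarrow>
      'i \<Rightarrow> 'a \<Rightarrow> ('i \<times> 'a) set" where
  "dirlim_map I r A \<phi> i x = dirlim_rel I r A \<phi> `` {(i, x)}"

definition dirlim ::
    "'i set \<Rightarrow> 'i rel \<Rightarrow> ('i \<Rightarrow> ('a, 'c) monoid_scheme) \<Rightarrow> ('i \<Rightarrow> 'i \<Rightarrow> 'a \<Rightarrow> 'a) \<Rightarrow>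
      ('i \<times> 'a) set monoid" where
  "dirlim I r A \<phi> =
     \<lparr>carrier = (SIGMA i:I. carrier (A i)) // dirlim_rel I r A \<phi>,
      monoid.mult = (\<lambda>P Q. \<Union>{dirlim_map I r A \<phi> k (\<phi> i k x \<otimes>\<^bsub>A k\<^esub> \<phi> j k y) | i x j y k.
         (i, x) \<in> P \<and> (j, y) \<in> Q \<and> k \<in> I \<and> (i, k) \<in> r \<and> (j, k) \<in> r}),
      one = (\<Union>i\<in>I. dirlim_map I r A \<phi> i \<one>\<^bsub>A i\<^esub>)\<rparr>"


section \<open>Ore localization of an action\<close>

definition action_kernel ::
    "('s, 'b) monoid_scheme \<Rightarrow> ('a, 'c) monoid_scheme \<Rightarrow> ('s \<Rightarrow> 'a \<Rightarrow> 'a) \<Rightarrow> 'a set" where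
  "action_kernel S A \<Lambda> = (\<Union>s\<in>carrier S. kernel A A (\<Lambda> s))"

abbreviation reduced_group ::
    "('s, 'b) monoid_scheme \<Rightarrow> ('a, 'c) monoid_scheme \<Rightarrow> ('s \<Rightarrow> 'a \<Rightarrow> 'a) \<Rightarrow> 'a set monoid" where
  "reduced_group S A \<Lambda> \<equiv> A Mod action_kernel S A \<Lambda>"

text \<open>The induced action on cosets, \<open>x + Ker \<mapsto> \<Lambda>\<^sub>s(x) + Ker\<close>.\<close>

definition reduced_action ::
    "('s, 'b) monoid_scheme \<Rightarrow> ('a, 'c) monoid_scheme \<Rightarrow> ('s \<Rightarrow> 'a \<Rightarrow> 'a) \<Rightarrow> 's \<Rightarrow> 'a set \<Rightarrow> 'a set"
  where
  "reduced_action S A \<Lambda> s C = (\<Union>x\<in>C. action_kernel S A \<Lambda> #>\<^bsub>A\<^esub> \<Lambda> s x)"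

definition fraction_preorder ::
    "('s, 'b) monoid_scheme \<Rightarrow> ('g, 'c) monoid_scheme \<Rightarrow> ('s \<Rightarrow> 'g) \<Rightarrow> 'g rel" where
  "fraction_preorder S G \<iota> =
     {(g\<^sub>1, g\<^sub>2). g\<^sub>1 \<in> carrier G \<and> g\<^sub>2 \<in> carrier G \<and> inv\<^bsub>G\<^esub> g\<^sub>2 \<otimes>\<^bsub>G\<^esub> g\<^sub>1 \<in> \<iota> ` carrier S}"

text \<open>
  The transition map from index \<open>g\<^sub>1\<close> to \<open>g\<^sub>2\<close> is the induced action of the element \<open>s\<close> of \<open>S\<close> with
  \<open>g\<^sub>1 = g\<^sub>2 s\<close>.
\<close>

definition ore_transition ::
    "('s, 'b) monoid_scheme \<Rightarrow> ('g, 'd) monoid_scheme \<Rightarrow> ('s \<Rightarrow> 'g) \<Rightarrow>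
      ('a, 'c) monoid_scheme \<Rightarrow> ('s \<Rightarrow> 'a \<Rightarrow> 'a) \<Rightarrow> 'g \<Rightarrow> 'g \<Rightarrow> 'a set \<Rightarrow> 'a set" where
  "ore_transition S G \<iota> A \<Lambda> g\<^sub>1 g\<^sub>2 =
     reduced_action S A \<Lambda> (inv_into (carrier S) \<iota> (inv\<^bsub>G\<^esub> g\<^sub>2 \<otimes>\<^bsub>G\<^esub> g\<^sub>1))"

definition ore_group ::
    "('s, 'b) monoid_scheme \<Rightarrow> ('g, 'd) monoid_scheme \<Rightarrow> ('s \<Rightarrow> 'g) \<Rightarrow>
      ('a, 'c) monoid_scheme \<Rightarrow> ('s \<Rightarrow> 'a \<Rightarrow> 'a) \<Rightarrow> ('g \<times> 'a set) set monoid" where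
  "ore_group S G \<iota> A \<Lambda> =
     dirlim (carrier G) (fraction_preorder S G \<iota>) (\<lambda>_. reduced_group S A \<Lambda>)
       (ore_transition S G \<iota> A \<Lambda>)"

definition ore_map ::
    "('s, 'b) monoid_scheme \<Rightarrow> ('g, 'd) monoid_scheme \<Rightarrow> ('s \<Rightarrow> 'g) \<Rightarrow>
      ('a, 'c) monoid_scheme \<Rightarrow> ('s \<Rightarrow> 'a \<Rightarrow> 'a) \<Rightarrow> 'g \<Rightarrow> 'a set \<Rightarrow> ('g \<times> 'a set) set" where
  "ore_map S G \<iota> A \<Lambda> =
     dirlim_map (carrier G) (fraction_preorder S G \<iota>) (\<lambda>_. reduced_group S A \<Lambda>)
       (ore_transition S G \<iota> A \<Lambda>)"

text \<open>
  Left translation of the indices permutes the equivalence classes; this is the action determined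
  by \<open>ore_action_ore_map\<close> below, since the maps \<open>ore_map S G \<iota> A \<Lambda> h\<close> jointly cover the limit
  (\<open>ore_group_cover\<close>).
\<close>

definition ore_action ::
    "('g, 'd) monoid_scheme \<Rightarrow> 'g \<Rightarrow> ('g \<times> 'a set) set \<Rightarrow> ('g \<times> 'a set) set" where
  "ore_action G g P = (\<lambda>(h, y). (g \<otimes>\<^bsub>G\<^esub> h, y)) ` P"

lemma ore_group_cover:
  "carrier (ore_group S G \<iota> A \<Lambda>) =
     (\<Union>h\<in>carrier G. ore_map S G \<iota> A \<Lambda> h ` carrier (reduced_group S A \<Lambda>))"
  by (auto simp: ore_group_def ore_map_def dirlim_def dirlim_map_def quotient_def)

lemma ore_action_ore_map:
  assumes "group G" and g: "g \<in> carrier G" and h: "h \<in> carrier G"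
  shows "ore_action G g (ore_map S G \<iota> A \<Lambda> h y) = ore_map S G \<iota> A \<Lambda> (g \<otimes>\<^bsub>G\<^esub> h) y"
proof -
  interpret group G by fact
  let ?R = "dirlim_rel (carrier G) (fraction_preorder S G \<iota>) (\<lambda>_. reduced_group S A \<Lambda>)
       (ore_transition S G \<iota> A \<Lambda>)"
  have cancel: "inv\<^bsub>G\<^esub> (g' \<otimes>\<^bsub>G\<^esub> k) \<otimes>\<^bsub>G\<^esub> (g' \<otimes>\<^bsub>G\<^esub> i) = inv\<^bsub>G\<^esub> k \<otimes>\<^bsub>G\<^esub> i"
    if "g' \<in> carrier G" "i \<in> carrier G" "k \<in> carrier G" for g' i k
  proof -
    have "inv\<^bsub>G\<^esub> g' \<otimes>\<^bsub>G\<^esub> (g' \<otimes>\<^bsub>G\<^esub> i) = i"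
      using that by (simp add: m_assoc[symmetric])
    then show ?thesis using that by (simp add: inv_mult_group m_assoc)
  qed
  have shift: "((g' \<otimes>\<^bsub>G\<^esub> i, x), (g' \<otimes>\<^bsub>G\<^esub> j, z)) \<in> ?R"
    if "((i, x), (j, z)) \<in> ?R" and g': "g' \<in> carrier G" for g' i j x z
  proof -
    from that obtain k where k: "k \<in> carrier G" "i \<in> carrier G" "j \<in> carrier G"
      "(i, k) \<in> fraction_preorder S G \<iota>" "(j, k) \<in> fraction_preorder S G \<iota>"
      "ore_transition S G \<iota> A \<Lambda> i k x = ore_transition S G \<iota> A \<Lambda> j k z"
      "x \<in> carrier (reduced_group S A \<Lambda>)" "z \<in> carrier (reduced_group S A \<Lambda>)"
      by (auto simp: dirlim_rel_def)
    then show ?thesis using g'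
      by (auto simp: dirlim_rel_def fraction_preorder_def ore_transition_def cancel
          intro!: bexI[of _ "g' \<otimes>\<^bsub>G\<^esub> k"])
  qed
  show ?thesis
  proof (intro equalityI subsetI)
    fix p assume "p \<in> ore_action G g (ore_map S G \<iota> A \<Lambda> h y)"
    then show "p \<in> ore_map S G \<iota> A \<Lambda> (g \<otimes>\<^bsub>G\<^esub> h) y"
      using shift[OF _ g] by (auto simp: ore_action_def ore_map_def dirlim_map_def)
  next
    fix p assume p: "p \<in> ore_map S G \<iota> A \<Lambda> (g \<otimes>\<^bsub>G\<^esub> h) y"
    obtain j z where jz: "p = (j, z)" by (cases p)
    with p have R: "((g \<otimes>\<^bsub>G\<^esub> h, y), (j, z)) \<in> ?R" by (simp add: ore_map_def dirlim_map_def)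
    then have j: "j \<in> carrier G" by (simp add: dirlim_rel_def)
    have "((h, y), (inv\<^bsub>G\<^esub> g \<otimes>\<^bsub>G\<^esub> j, z)) \<in> ?R"
      using shift[OF R, of "inv\<^bsub>G\<^esub> g"] g h by (simp add: m_assoc[symmetric])
    moreover have "p = (\<lambda>(h, y). (g \<otimes>\<^bsub>G\<^esub> h, y)) (inv\<^bsub>G\<^esub> g \<otimes>\<^bsub>G\<^esub> j, z)"
      using jz g j by (simp add: m_assoc[symmetric])
    ultimately show "p \<in> ore_action G g (ore_map S G \<iota> A \<Lambda> h y)"
      unfolding ore_action_def ore_map_def dirlim_map_def by blast
  qed
qed

end

theory Submission
  imports Defs
begin

text \<open>
  Choosing for each element of a trajectory its lightest representation turns Shearer's inequality
  for projections of finite sets of functions into a fractional subadditivity of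
  \<open>F \<mapsto> log |T\<^sub>F(E)|\<close>. Covering a Foelner set by translates of an arbitrary finite set then
  shows that \<open>H_alg\<close> is the infimum of \<open>log |T\<^sub>K(E)| / |K|\<close> over all non-empty finite \<open>K\<close>, so no
  Ornstein--Weiss argument is needed.

  Let \<open>\<pi> = \<epsilon>\<^sub>1\<close> composed with the quotient map. It carries \<open>T\<^sub>K(E)\<close> onto \<open>T\<^sub>K(\<pi> E)\<close>, and finitely many
  elements identified by \<open>\<pi>\<close> are already identified by one \<open>\<Lambda> s\<close>; since \<open>\<Lambda> s\<close> maps
  \<open>T\<^sub>K(E)\<close> onto the trajectory of the translate \<open>s K\<close>, both infima agree along a Foelner net of \<open>S\<close>,
  which is also one of \<open>G\<close>. Every finite subset of the localization is a \<open>G\<close>-translate of some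
  \<open>\<pi> E\<close>, and translating \<open>E\<close> by \<open>g\<close> amounts to replacing \<open>K\<close> by \<open>K g\<close>.
\<close>

section \<open>Shearer's inequality\<close>

text \<open>Group the restrictions by their value at \<open>x\<close>. Different values give
  disjoint groups, and inside one group the value at \<open>x\<close> is constant, so forgetting it
  is injective. This recursion drives the induction in \<open>Shearer\<close>.\<close>

lemma card_restrict_insert:
  fixes B :: "('x \<Rightarrow> 'y) set"
  assumes "finite B" and "x \<notin> V"
  shows "card ((\<lambda>b. restrict b (insert x V)) ` B) =
    (\<Sum>a\<in>(\<lambda>b. b x) ` B. card ((\<lambda>b. restrict b V) ` {b \<in> B. b x = a}))"
proof -
  let ?C = "\<lambda>a. (\<lambda>b. restrict b (insert x V)) ` {b \<in> B. b x = a}"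
  have "(\<lambda>b. restrict b (insert x V)) ` B = (\<Union>a\<in>(\<lambda>b. b x) ` B. ?C a)"
    by auto
  also have "card \<dots> = (\<Sum>a\<in>(\<lambda>b. b x) ` B. card (?C a))"
  proof (rule card_UN_disjoint)
    show "\<forall>i\<in>(\<lambda>b. b x) ` B. \<forall>j\<in>(\<lambda>b. b x) ` B. i \<noteq> j \<longrightarrow> ?C i \<inter> ?C j = {}"
    proof (intro ballI impI)
      fix a a' :: 'y assume "a \<noteq> a'"
      have val: "c x = a" if "c \<in> ?C a" for c a
        using that by auto
      show "?C a \<inter> ?C a' = {}"
      proof (rule equals0I)
        fix c assume c: "c \<in> ?C a \<inter> ?C a'"
        have "c x = a" using c by (intro val) (rule IntD1)
        moreover have "c x = a'" using c by (intro val) (rule IntD2)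
        ultimately show False using \<open>a \<noteq> a'\<close> by simp
      qed
    qed
  qed (simp_all add: assms(1))
  also have "\<dots> = (\<Sum>a\<in>(\<lambda>b. b x) ` B. card ((\<lambda>b. restrict b V) ` {b \<in> B. b x = a}))"
  proof (rule sum.cong[OF refl])
    fix a
    have "(\<lambda>c. restrict c V) ` ?C a = (\<lambda>b. restrict b V) ` {b \<in> B. b x = a}"
      unfolding image_image restrict_restrict by (simp only: Int_absorb1 subset_insertI)
    then have "card ((\<lambda>b. restrict b V) ` {b \<in> B. b x = a}) = card ((\<lambda>c. restrict c V) ` ?C a)"
      by (simp only:)
    also have "\<dots> = card (?C a)"
    proof (rule card_image)
      show "inj_on (\<lambda>c. restrict c V) (?C a)"
      proof (rule inj_onI)
        fix c c' assume c: "c \<in> ?C a" "c' \<in> ?C a" and eq: "restrict c V = restrict c' V"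
        have "c y = c' y" for y
        proof (cases "y \<in> V")
          case True
          then show ?thesis using fun_cong[OF eq, of y] by simp
        next
          case False
          then show ?thesis using c by (cases "y = x") auto
        qed
        then show "c = c'" ..
      qed
    qed
    finally show "card (?C a) = card ((\<lambda>b. restrict b V) ` {b \<in> B. b x = a})" ..
  qed
  finally show ?thesis .
qed

text \<open>
  Induction on the ground set: fibre \<open>B\<close> over the value at the new point \<open>x\<close>. The AM-GM inequality
  plays the role of Hoelder's inequality for the \<open>k\<close> factors whose index set contains \<open>x\<close>.
\<close>

lemma Shearer:
  fixes B :: "('x \<Rightarrow> 'y) set" and F :: "'i \<Rightarrow> 'x set"
  assumes "finite V" and "finite I" and k: "k > 0" and "finite B"
    and "\<And>x. x \<in> V \<Longrightarrow> card {i \<in> I. x \<in> F i} = k"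
  shows "real (card ((\<lambda>b. restrict b V) ` B)) \<le>
    (\<Prod>i\<in>I. real (card ((\<lambda>b. restrict b (F i)) ` B))) powr (1 / k)"
  using assms(1,4,5)
proof (induction V arbitrary: B F rule: finite_induct)
  case empty
  show ?case
  proof (cases "B = {}")
    case False
    \<comment> \<open>Over the empty ground set all functions restrict to the same one, so it
      suffices that the right-hand side is at least 1; each of its factors counts a non-empty
      set.\<close>
    have "1 \<le> (\<Prod>i\<in>I. real (card ((\<lambda>b. restrict b (F i)) ` B)))"
      using False empty by (intro prod_ge_1) (simp add: Suc_leI card_gt_0_iff)
    then have "1 \<le> (\<Prod>i\<in>I. real (card ((\<lambda>b. restrict b (F i)) ` B))) powr (1 / k)"
      by (rule ge_one_powr_ge_zero) simp
    moreover have "(\<lambda>b. restrict b {}) ` B = {\<lambda>_. undefined}"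
      using False by (auto simp: restrict_def)
    then have "real (card ((\<lambda>b. restrict b {}) ` B)) = 1"
      by (simp only: card_insert_disjoint) simp
    ultimately show ?thesis by (simp only:)
  qed simp
next
  case (insert x V)
  show ?case
  proof (cases "B = {}")
    case False
    \<comment> \<open>\<open>Ba a\<close> is the fibre over the value \<open>a\<close>, and
      \<open>J\<close> holds the \<open>k\<close> indices whose set contains \<open>x\<close>.
      \<open>P i\<close> counts a projection of all of \<open>B\<close>, and \<open>c i a\<close>
      the projection of one fibre with \<open>x\<close> dropped from \<open>F i\<close>.\<close>
    define A where "A = (\<lambda>b. b x) ` B"
    define Ba where "Ba a = {b \<in> B. b x = a}" for a
    define J where "J = {i \<in> I. x \<in> F i}"
    define P where "P i = real (card ((\<lambda>b. restrict b (F i)) ` B))" for i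
    define c where "c i a = real (card ((\<lambda>b. restrict b (F i - {x})) ` Ba a))" for i a
    have J: "finite J" "J \<subseteq> I" "card J = k"
      using insert.prems(2)[of x] \<open>finite I\<close> by (auto simp: J_def)
    then have "J \<noteq> {}" using k by auto
    have Ba: "finite (Ba a)" for a using insert.prems by (simp add: Ba_def)
    have P0: "P i > 0" for i using False insert.prems by (simp add: P_def card_gt_0_iff)
    have c0: "c i a \<ge> 0" for i a by (simp add: c_def)
    have PJ: "(\<Sum>a\<in>A. c i a) = P i" if "i \<in> J" for i
    proof -
      have "insert x (F i - {x}) = F i" using that by (auto simp: J_def)
      then show ?thesis
        using card_restrict_insert[OF insert.prems(1), of x "F i - {x}"]
        by (simp add: P_def c_def A_def Ba_def)
    qed
    have PI: "c i a \<le> P i" if "i \<in> I - J" for i a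
    proof -
      have "F i - {x} = F i" using that by (auto simp: J_def)
      then show ?thesis
        using insert.prems by (auto simp: c_def P_def Ba_def intro!: card_mono)
    qed
    \<comment> \<open>The sets \<open>F i - {x}\<close> still cover each point of \<open>V\<close>
      exactly \<open>k\<close> times, so the induction hypothesis applies to the fibre. Pulling out
      every \<open>P i\<close> leaves the ratios \<open>c i a / P i\<close>, at most 1 off
      \<open>J\<close>; the \<open>k\<close>-th root of the product of the \<open>k\<close> ratios
      in \<open>J\<close> is at most their mean.\<close>
    have bound: "real (card ((\<lambda>b. restrict b V) ` Ba a)) \<le>
        (\<Prod>i\<in>I. P i) powr (1 / k) * (\<Sum>i\<in>J. c i a / P i / k)" for a
    proof -
      have "card {i \<in> I. y \<in> F i - {x}} = k" if "y \<in> V" for y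
      proof -
        have "{i \<in> I. y \<in> F i - {x}} = {i \<in> I. y \<in> F i}"
          using insert.hyps that by auto
        then show ?thesis using insert.prems(2)[of y] that by simp
      qed
      then have "real (card ((\<lambda>b. restrict b V) ` Ba a)) \<le> (\<Prod>i\<in>I. c i a) powr (1 / k)"
        unfolding c_def by (rule insert.IH[OF Ba])
      also have "\<dots> \<le> ((\<Prod>i\<in>I. P i) * (\<Prod>i\<in>J. c i a / P i)) powr (1 / k)"
      proof (rule powr_mono2)
        have split: "(\<Prod>i\<in>I. f i) = (\<Prod>i\<in>J. f i) * (\<Prod>i\<in>I - J. f i)" for f :: "'i \<Rightarrow> real"
          using prod.subset_diff[OF J(2) \<open>finite I\<close>, of f] by (simp add: mult.commute)
        have "(\<Prod>i\<in>J. c i a) = (\<Prod>i\<in>J. P i) * (\<Prod>i\<in>J. c i a / P i)"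
          using P0 by (simp add: prod.distrib[symmetric] less_imp_neq[symmetric])
        moreover have "(\<Prod>i\<in>I - J. c i a) \<le> (\<Prod>i\<in>I - J. P i)"
          using PI c0 by (intro prod_mono) auto
        moreover have "(\<Prod>i\<in>J. c i a) \<ge> 0" using c0 by (intro prod_nonneg) auto
        ultimately have "(\<Prod>i\<in>I. c i a) \<le>
            ((\<Prod>i\<in>J. P i) * (\<Prod>i\<in>J. c i a / P i)) * (\<Prod>i\<in>I - J. P i)"
          unfolding split by (metis mult_left_mono)
        then show "(\<Prod>i\<in>I. c i a) \<le> (\<Prod>i\<in>I. P i) * (\<Prod>i\<in>J. c i a / P i)"
          unfolding split[of P] by (simp only: ac_simps)
      qed (use k c0 in \<open>auto intro: prod_nonneg\<close>)
      also have "\<dots> = (\<Prod>i\<in>I. P i) powr (1 / k) * (\<Prod>i\<in>J. c i a / P i) powr (1 / k)"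
        by (rule powr_mult)
      also have "\<dots> \<le> (\<Prod>i\<in>I. P i) powr (1 / k) * (\<Sum>i\<in>J. c i a / P i / k)"
        using arith_geom_mean[OF J(1) \<open>J \<noteq> {}\<close>, of "\<lambda>i. c i a / P i"] c0 P0 J(3)
        by (intro mult_left_mono) (auto simp: less_imp_le)
      finally show ?thesis .
    qed
    have "real (card ((\<lambda>b. restrict b (insert x V)) ` B)) =
        (\<Sum>a\<in>A. real (card ((\<lambda>b. restrict b V) ` Ba a)))"
      using card_restrict_insert[OF insert.prems(1) insert.hyps(2)] by (simp add: A_def Ba_def)
    also have "\<dots> \<le> (\<Sum>a\<in>A. (\<Prod>i\<in>I. P i) powr (1 / k) * (\<Sum>i\<in>J. c i a / P i / k))"
      by (intro sum_mono bound)
    also have "\<dots> = (\<Prod>i\<in>I. P i) powr (1 / k) * (\<Sum>i\<in>J. (\<Sum>a\<in>A. c i a) / P i / k)"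
      by (simp add: sum_distrib_left[symmetric] sum_divide_distrib sum.swap[of _ A])
    \<comment> \<open>By \<open>PJ\<close> each of the \<open>k\<close> ratios sums to 1 over the
      values \<open>a\<close>, hence so does their mean.\<close>
    also have "(\<Sum>i\<in>J. (\<Sum>a\<in>A. c i a) / P i / k) = 1"
      using PJ P0 J k by (simp add: less_imp_neq[symmetric])
    finally show ?thesis unfolding P_def mult_1_right .
  qed simp
qed

section \<open>Trajectories\<close>

text \<open>
  Distinct powers of two as weights make the total weight of a partial choice of summands determine
  that choice; hence among all ways to write an element as a sum there is a unique lightest one,
  and every part of a lightest representation is itself lightest.
\<close>

lemma trajectory_section:
  assumes "comm_group A" and V: "finite V" and E: "finite E" "E \<noteq> {}"
    and \<alpha>: "\<And>s x. s \<in> V \<Longrightarrow> x \<in> E \<Longrightarrow> \<alpha> s x \<in> carrier A"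
  obtains B where "B \<subseteq> V \<rightarrow>\<^sub>E E"
    and "card B = card (trajectory A \<alpha> V E)"
    and "\<And>W. W \<subseteq> V \<Longrightarrow>
      card ((\<lambda>b. restrict b W) ` B) \<le> card (trajectory A \<alpha> W E)"
proof -
  interpret comm_group A by fact
  define \<sigma> where "\<sigma> W b = finprod A (\<lambda>s. \<alpha> s (b s)) W" for W b
  obtain code :: "_ \<Rightarrow> nat" where code: "inj_on code (V \<times> E)"
    using finite_imp_inj_to_nat_seg[of "V \<times> E"] V E by blast
  define w where "w W b = (\<Sum>s\<in>W. (2::nat) ^ code (s, b s))" for W b
  have w_inj: "b s = b' s" if "w W b = w W b'" "W \<subseteq> V" "b \<in> V \<rightarrow>\<^sub>E E" "b' \<in> V \<rightarrow>\<^sub>E E" "s \<in> W"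
    for W b b' s
  proof -
    \<comment> \<open>The weight is the binary number whose digits mark the codes of the pairs
      \<open>(s, b s)\<close>; \<open>set_encode_eq\<close> therefore recovers the graph of
      \<open>b\<close> over \<open>W\<close> from it.\<close>
    have enc: "w W b = set_encode ((\<lambda>s. code (s, b s)) ` W)" if "b \<in> V \<rightarrow>\<^sub>E E" for b
    proof -
      have "inj_on (\<lambda>s. code (s, b s)) W"
      proof (rule inj_onI)
        fix s t assume "s \<in> W" "t \<in> W" "code (s, b s) = code (t, b t)"
        then show "s = t" using inj_onD[OF code, of "(s, b s)" "(t, b t)"] that \<open>W \<subseteq> V\<close>
          by (auto simp: PiE_iff)
      qed
      then show ?thesis by (simp add: w_def set_encode_def sum.reindex o_def)
    qed
    have "finite W" using that V finite_subset by blast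
    then have "(\<lambda>s. code (s, b s)) ` W = (\<lambda>s. code (s, b' s)) ` W"
      using that by (simp add: enc set_encode_eq)
    then have "code (s, b s) \<in> (\<lambda>s. code (s, b' s)) ` W"
      using imageI[OF \<open>s \<in> W\<close>, of "\<lambda>s. code (s, b s)"] by simp
    then obtain t where "t \<in> W" "code (s, b s) = code (t, b' t)" by (rule imageE) simp
    then show ?thesis using inj_onD[OF code, of "(s, b s)" "(t, b' t)"] that
      by (auto simp: PiE_iff)
  qed
  have T: "trajectory A \<alpha> W E = \<sigma> W ` (V \<rightarrow>\<^sub>E E)" if "W \<subseteq> V" for W
  proof (intro equalityI subsetI)
    fix x assume "x \<in> trajectory A \<alpha> W E"
    then obtain e where e: "e \<in> W \<rightarrow> E" "x = \<sigma> W e" by (auto simp: trajectory_def \<sigma>_def)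
    \<comment> \<open>Outside \<open>W\<close> the choice \<open>e\<close> is unconstrained;
      \<open>z\<close> is a filler from \<open>E\<close> that turns it into a choice on all of
      \<open>V\<close>.\<close>
    obtain z where "z \<in> E" using E by blast
    define b where "b = restrict (\<lambda>s. if s \<in> W then e s else z) V"
    have "b \<in> V \<rightarrow>\<^sub>E E" using e \<open>z \<in> E\<close> by (auto simp: b_def)
    moreover have "x = \<sigma> W b" unfolding e \<sigma>_def
      using e \<alpha> \<open>W \<subseteq> V\<close> by (intro finprod_cong') (auto simp: b_def Pi_def subset_eq)
    ultimately show "x \<in> \<sigma> W ` (V \<rightarrow>\<^sub>E E)" by blast
  next
    fix x assume "x \<in> \<sigma> W ` (V \<rightarrow>\<^sub>E E)"
    then show "x \<in> trajectory A \<alpha> W E"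
      using that by (force simp: trajectory_def \<sigma>_def PiE_iff)
  qed
  have fin: "finite (V \<rightarrow>\<^sub>E E)" using V E by (intro finite_PiE) auto
  \<comment> \<open>The lightest representations over the whole of \<open>V\<close>; this one set
    serves every \<open>W\<close>.\<close>
  define B where "B = {b \<in> V \<rightarrow>\<^sub>E E. \<forall>b' \<in> V \<rightarrow>\<^sub>E E. \<sigma> V b' = \<sigma> V b \<longrightarrow> w V b \<le> w V b'}"
  have split: "\<sigma> V b = \<sigma> W b \<otimes>\<^bsub>A\<^esub> \<sigma> (V - W) b" "w V b = w W b + w (V - W) b"
    if "W \<subseteq> V" "b \<in> V \<rightarrow>\<^sub>E E" for W b
  proof -
    have *: "W \<union> (V - W) = V" "finite W" "finite (V - W)" "W \<inter> (V - W) = {}"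
      using that V finite_subset by auto
    show "\<sigma> V b = \<sigma> W b \<otimes>\<^bsub>A\<^esub> \<sigma> (V - W) b"
      using that \<alpha> finprod_Un_disjoint[OF *(2-4), of "\<lambda>s. \<alpha> s (b s)"]
      unfolding *(1) \<sigma>_def by (force simp: PiE_iff)
    show "w V b = w W b + w (V - W) b"
      using sum.union_disjoint[OF *(2-4)] unfolding *(1) w_def by blast
  qed
  have light: "w W b \<le> w W b'"
    if "b \<in> B" "b' \<in> B" "\<sigma> W b = \<sigma> W b'" "W \<subseteq> V" for b b' W
  proof -
    \<comment> \<open>Exchange argument: replace the part of \<open>b\<close> over \<open>W\<close>
      by that of \<open>b'\<close>. The sum over \<open>V\<close> does not change, so minimality of
      \<open>b\<close> bounds its weight over \<open>W\<close> by that of \<open>b'\<close>.\<close>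
    define b'' where "b'' = (\<lambda>s. if s \<in> W then b' s else b s)"
    have b: "b \<in> V \<rightarrow>\<^sub>E E" "b' \<in> V \<rightarrow>\<^sub>E E" using that by (auto simp: B_def)
    have b'': "b'' \<in> V \<rightarrow>\<^sub>E E" using b that by (auto simp: b''_def PiE_iff extensional_def)
    have "\<sigma> W b'' = \<sigma> W b'" "\<sigma> (V - W) b'' = \<sigma> (V - W) b"
      using b \<alpha> that unfolding \<sigma>_def
      by (intro finprod_cong'; force simp: b''_def PiE_iff)+
    moreover have "w W b'' = w W b'" "w (V - W) b'' = w (V - W) b"
      unfolding w_def by (intro sum.cong; simp add: b''_def)+
    moreover have "w V b \<le> w V b''" if "\<sigma> V b'' = \<sigma> V b"
      using \<open>b \<in> B\<close> b'' that by (auto simp: B_def)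
    ultimately show ?thesis using split[OF that(4)] b b'' that(3) by simp
  qed
  have inj: "inj_on (\<sigma> W) ((\<lambda>b. restrict b W) ` B)" and
    sub: "\<sigma> W ` (\<lambda>b. restrict b W) ` B \<subseteq> \<sigma> W ` (V \<rightarrow>\<^sub>E E)" if "W \<subseteq> V" for W
  proof -
    have r: "\<sigma> W (restrict b W) = \<sigma> W b" if "b \<in> B" for b
      using that \<open>W \<subseteq> V\<close> \<alpha> unfolding \<sigma>_def B_def
      by (intro finprod_cong'; force simp: PiE_iff)
    show "inj_on (\<sigma> W) ((\<lambda>b. restrict b W) ` B)"
    proof (rule inj_onI)
      fix c c' assume "c \<in> (\<lambda>b. restrict b W) ` B" "c' \<in> (\<lambda>b. restrict b W) ` B"
        and eq: "\<sigma> W c = \<sigma> W c'"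
      then obtain b b' where b: "b \<in> B" "b' \<in> B" "c = restrict b W" "c' = restrict b' W" by auto
      then have "\<sigma> W b = \<sigma> W b'" using eq r by simp
      \<comment> \<open>\<open>light\<close> in both directions equates the weights over
        \<open>W\<close>, and equal weights force equal choices there.\<close>
      then have "w W b = w W b'" using light[of b b'] light[of b' b] b that by (simp add: order_antisym)
      then have "b s = b' s" if "s \<in> W" for s
        using w_inj[of W b b' s] that b \<open>W \<subseteq> V\<close> by (simp add: B_def)
      then show "c = c'" using b by (auto simp: restrict_def)
    qed
    show "\<sigma> W ` (\<lambda>b. restrict b W) ` B \<subseteq> \<sigma> W ` (V \<rightarrow>\<^sub>E E)"
      using r by (auto simp: B_def)
  qed
  have le: "card ((\<lambda>b. restrict b W) ` B) \<le> card (\<sigma> W ` (V \<rightarrow>\<^sub>E E))" if "W \<subseteq> V" for W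
    using card_inj_on_le[OF inj sub] that fin by blast
  have rV: "(\<lambda>b. restrict b V) ` B = B"
    by (force simp: B_def PiE_iff extensional_restrict image_iff)
  have ge: "card (\<sigma> V ` (V \<rightarrow>\<^sub>E E)) \<le> card B"
  proof (rule surj_card_le)
    show "finite B" using fin by (simp add: B_def)
    show "\<sigma> V ` (V \<rightarrow>\<^sub>E E) \<subseteq> \<sigma> V ` B"
    proof clarify
      fix b assume b: "b \<in> V \<rightarrow>\<^sub>E E"
      \<comment> \<open>An element of the trajectory has only finitely many representations, so a
        lightest one exists.\<close>
      obtain b' where b': "is_arg_min (w V) (\<lambda>b'. b' \<in> V \<rightarrow>\<^sub>E E \<and> \<sigma> V b' = \<sigma> V b) b'"
        using b ex_is_arg_min_if_finite[of "{b' \<in> V \<rightarrow>\<^sub>E E. \<sigma> V b' = \<sigma> V b}" "w V"] fin by auto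
      then have "b' \<in> B" "\<sigma> V b' = \<sigma> V b" by (auto simp: B_def is_arg_min_linorder)
      then show "\<sigma> V b \<in> \<sigma> V ` B" by (metis imageI)
    qed
  qed
  show thesis
  proof (rule that[of B])
    show "B \<subseteq> V \<rightarrow>\<^sub>E E" by (auto simp: B_def)
    show "card B = card (trajectory A \<alpha> V E)"
      using ge le[of V] T[of V] rV by simp
    show "card ((\<lambda>b. restrict b W) ` B) \<le> card (trajectory A \<alpha> W E)" if "W \<subseteq> V" for W
      using le[OF that] T[OF that] by simp
  qed
qed

text \<open>A homomorphism passes through finite products, so it transports trajectories summand by
  summand, with \<open>j\<close> relabelling the indices and \<open>p\<close> moving the points. It
  is applied to left translation by \<open>s\<close> (\<open>h\<close> is the action of
  \<open>s\<close>), to the localization map (\<open>j\<close> is the embedding) and to right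
  translation in a group (\<open>h\<close> is the identity, \<open>p\<close> the action of
  \<open>g\<close>).\<close>

lemma trajectory_equivariant:
  assumes "comm_group A" and "comm_group A'" and h: "h \<in> hom A A'" and j: "inj_on j F"
    and \<alpha>: "\<And>s x. s \<in> F \<Longrightarrow> x \<in> E \<Longrightarrow> \<alpha> s x \<in> carrier A"
    and equiv: "\<And>s x. s \<in> F \<Longrightarrow> x \<in> E \<Longrightarrow> \<beta> (j s) (p x) = h (\<alpha> s x)"
  shows "trajectory A' \<beta> (j ` F) (p ` E) = h ` trajectory A \<alpha> F E"
proof -
  interpret A: comm_group A by fact
  interpret A': comm_group A' by fact
  have hom: "h (finprod A g F) = finprod A' (\<lambda>s. h (g s)) F" if "g \<in> F \<rightarrow> carrier A" for g
    using that
  proof (induction F rule: infinite_finite_induct)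
    case (insert x F)
    then show ?case using hom_mult[OF h] hom_in_carrier[OF h] by (simp add: Pi_iff)
  qed (use hom_one[OF h] A.group_axioms A'.group_axioms in auto)
  have eq: "finprod A' (\<lambda>t. \<beta> t (e' t)) (j ` F) = h (finprod A (\<lambda>s. \<alpha> s (e s)) F)"
    if e: "e \<in> F \<rightarrow> E" and e': "\<And>s. s \<in> F \<Longrightarrow> e' (j s) = p (e s)" for e e'
  proof -
    have \<beta>: "\<beta> (j s) (e' (j s)) = h (\<alpha> s (e s))" if "s \<in> F" for s
      using that e e' equiv by (auto simp: Pi_iff)
    have cl: "h (\<alpha> s (e s)) \<in> carrier A'" if "s \<in> F" for s
      using that e \<alpha> by (auto simp: Pi_iff intro: hom_in_carrier[OF h])
    have "finprod A' (\<lambda>t. \<beta> t (e' t)) (j ` F) = finprod A' (\<lambda>s. \<beta> (j s) (e' (j s))) F"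
      using cl \<beta> by (intro A'.finprod_reindex j) auto
    also have "\<dots> = finprod A' (\<lambda>s. h (\<alpha> s (e s))) F"
      using cl \<beta> by (intro A'.finprod_cong') auto
    also have "\<dots> = h (finprod A (\<lambda>s. \<alpha> s (e s)) F)"
      using e \<alpha> by (intro hom[symmetric]) (auto simp: Pi_iff)
    finally show ?thesis .
  qed
  show ?thesis
  proof (intro equalityI subsetI)
    fix y assume "y \<in> trajectory A' \<beta> (j ` F) (p ` E)"
    then obtain e' where e': "e' \<in> j ` F \<rightarrow> p ` E" "y = finprod A' (\<lambda>t. \<beta> t (e' t)) (j ` F)"
      by (auto simp: trajectory_def)
    then have "\<forall>s\<in>F. \<exists>x\<in>E. e' (j s) = p x" by (auto simp: Pi_iff)
    then obtain e where "\<forall>s\<in>F. e s \<in> E \<and> e' (j s) = p (e s)" by metis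
    then have e: "e \<in> F \<rightarrow> E" "\<And>s. s \<in> F \<Longrightarrow> e' (j s) = p (e s)" by auto
    have "y = h (finprod A (\<lambda>s. \<alpha> s (e s)) F)" unfolding e'(2) by (rule eq[OF e])
    then show "y \<in> h ` trajectory A \<alpha> F E" using e(1) by (auto simp: trajectory_def)
  next
    fix y assume "y \<in> h ` trajectory A \<alpha> F E"
    then obtain e where e: "e \<in> F \<rightarrow> E" "y = h (finprod A (\<lambda>s. \<alpha> s (e s)) F)"
      by (auto simp: trajectory_def)
    \<comment> \<open>\<open>inv_into\<close> reads the index \<open>s\<close> back off
      \<open>j s\<close>, which carries the choice \<open>e\<close> over to the image of
      \<open>F\<close>.\<close>
    let ?e' = "\<lambda>t. p (e (inv_into F j t))"
    have "y = finprod A' (\<lambda>t. \<beta> t (?e' t)) (j ` F)"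
      unfolding e(2) using j by (intro eq[OF e(1), symmetric]) simp
    moreover have "?e' \<in> j ` F \<rightarrow> p ` E" using e(1) j by (auto simp: Pi_iff)
    ultimately show "y \<in> trajectory A' \<beta> (j ` F) (p ` E)" by (auto simp: trajectory_def)
  qed
qed

text \<open>Right cancellation gives \<open>F\<close> and its translate the same size, so each
  exceeds their intersection by the same amount. The Foelner condition may thus be used in either
  direction.\<close>

lemma (in monoid_cancel) card_Diff_right_translate:
  assumes F: "F \<subseteq> carrier G" "finite F" and s: "s \<in> carrier G"
  shows "card (F - (\<lambda>f. f \<otimes> s) ` F) = card ((\<lambda>f. f \<otimes> s) ` F - F)"
proof -
  have "inj_on (\<lambda>f. f \<otimes> s) F"
    using F s by (intro inj_onI) (auto dest: r_cancel)
  then have "card ((\<lambda>f. f \<otimes> s) ` F) = card F" by (rule card_image)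
  then show ?thesis using F by (simp add: card_Diff_subset_Int Int_commute)
qed

section \<open>Entropy of a finite set as an infimum over index sets\<close>

locale action_on_finite_set = M: monoid_cancel M + A: comm_group A
  for M :: "('m, 'b) monoid_scheme" and A :: "('a, 'c) monoid_scheme" +
  fixes \<alpha> :: "'m \<Rightarrow> 'a \<Rightarrow> 'a" and E :: "'a set"
  assumes act: "left_action M A \<alpha>"
    and E: "finite E" "E \<subseteq> carrier A" "\<one>\<^bsub>A\<^esub> \<in> E"
begin

definition log_size :: "'m set \<Rightarrow> real" where
  "log_size F = ln (real (card (trajectory A \<alpha> F E)))"

lemma act_hom: "s \<in> carrier M \<Longrightarrow> \<alpha> s \<in> hom A A"
  using act by (simp add: left_action_def)

lemma act_closed [simp]: "s \<in> carrier M \<Longrightarrow> x \<in> carrier A \<Longrightarrow> \<alpha> s x \<in> carrier A"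
  using act_hom hom_in_carrier by fast

lemma act_one [simp]: "s \<in> carrier M \<Longrightarrow> \<alpha> s \<one>\<^bsub>A\<^esub> = \<one>\<^bsub>A\<^esub>"
  using act_hom hom_one A.group_axioms by blast

lemma act_mult: "s \<in> carrier M \<Longrightarrow> t \<in> carrier M \<Longrightarrow> x \<in> carrier A \<Longrightarrow>
    \<alpha> (s \<otimes>\<^bsub>M\<^esub> t) x = \<alpha> s (\<alpha> t x)"
  using act by (simp add: left_action_def)

lemma act_E: "F \<subseteq> carrier M \<Longrightarrow> s \<in> F \<Longrightarrow> x \<in> E \<Longrightarrow> \<alpha> s x \<in> carrier A"
  by (meson E(2) act_closed subsetD)

lemma trajectory_PiE:
  assumes "F \<subseteq> carrier M"
  shows "trajectory A \<alpha> F E = (\<lambda>e. finprod A (\<lambda>s. \<alpha> s (e s)) F) ` (F \<rightarrow>\<^sub>E E)"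
proof (intro equalityI subsetI)
  fix x assume "x \<in> trajectory A \<alpha> F E"
  then obtain e where e: "e \<in> F \<rightarrow> E" "x = finprod A (\<lambda>s. \<alpha> s (e s)) F"
    by (auto simp: trajectory_def)
  have "x = finprod A (\<lambda>s. \<alpha> s (restrict e F s)) F"
    unfolding e using e assms E by (intro A.finprod_cong') (auto simp: Pi_iff subset_eq)
  then show "x \<in> (\<lambda>e. finprod A (\<lambda>s. \<alpha> s (e s)) F) ` (F \<rightarrow>\<^sub>E E)"
    using e by (intro image_eqI[of _ _ "restrict e F"]) auto
next
  fix x assume "x \<in> (\<lambda>e. finprod A (\<lambda>s. \<alpha> s (e s)) F) ` (F \<rightarrow>\<^sub>E E)"
  then show "x \<in> trajectory A \<alpha> F E" by (auto simp: trajectory_def PiE_def)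
qed

lemma finite_trajectory:
  "F \<subseteq> carrier M \<Longrightarrow> finite F \<Longrightarrow> finite (trajectory A \<alpha> F E)"
  using E by (simp add: trajectory_PiE finite_PiE)

lemma one_in_trajectory: "F \<subseteq> carrier M \<Longrightarrow> \<one>\<^bsub>A\<^esub> \<in> trajectory A \<alpha> F E"
  unfolding trajectory_def using E
  by (intro CollectI exI[of _ "\<lambda>_. \<one>\<^bsub>A\<^esub>"]) (auto intro!: A.finprod_one_eqI[symmetric] dest: subsetD)

lemma trajectory_closed: "F \<subseteq> carrier M \<Longrightarrow> trajectory A \<alpha> F E \<subseteq> carrier A"
  using E by (force simp: trajectory_def Pi_iff intro!: A.finprod_closed)

lemma card_trajectory_ge_1: "F \<subseteq> carrier M \<Longrightarrow> finite F \<Longrightarrow> card (trajectory A \<alpha> F E) \<ge> 1"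
  using one_in_trajectory finite_trajectory by (metis One_nat_def Suc_leI card_gt_0_iff empty_iff)

lemma log_size_nonneg: "F \<subseteq> carrier M \<Longrightarrow> finite F \<Longrightarrow> log_size F \<ge> 0"
  using card_trajectory_ge_1 by (simp add: log_size_def)

lemma trajectory_mono:
  assumes "F \<subseteq> F'" and "finite F'" and F': "F' \<subseteq> carrier M"
  shows "trajectory A \<alpha> F E \<subseteq> trajectory A \<alpha> F' E"
proof
  fix x assume "x \<in> trajectory A \<alpha> F E"
  then obtain e where e: "e \<in> F \<rightarrow> E" "x = finprod A (\<lambda>s. \<alpha> s (e s)) F"
    by (auto simp: trajectory_def)
  \<comment> \<open>At the additional indices the neutral element, which lies in \<open>E\<close>,
    is chosen and contributes nothing.\<close>
  let ?e = "\<lambda>s. if s \<in> F then e s else \<one>\<^bsub>A\<^esub>"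
  have "x = finprod A (\<lambda>s. \<alpha> s (?e s)) F'"
    unfolding e using assms e E
    by (intro A.finprod_mono_neutral_cong_left) (auto simp: Pi_iff subset_eq)
  then show "x \<in> trajectory A \<alpha> F' E"
    using e E unfolding trajectory_def by (intro CollectI exI[of _ ?e]) auto
qed

lemma log_size_mono:
  assumes "F \<subseteq> F'" and "finite F'" and "F' \<subseteq> carrier M"
  shows "log_size F \<le> log_size F'"
proof -
  have "card (trajectory A \<alpha> F E) \<le> card (trajectory A \<alpha> F' E)"
    using assms by (intro card_mono finite_trajectory trajectory_mono)
  moreover have "card (trajectory A \<alpha> F E) \<ge> 1"
    using assms by (intro card_trajectory_ge_1) (auto dest: finite_subset)
  ultimately show ?thesis by (simp add: log_size_def)
qed

text \<open>Every element of the trajectory comes from a choice function from \<open>F\<close> to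
  \<open>E\<close>. This crude bound is applied only to the small part of a Foelner set that the
  translates do not cover evenly.\<close>

lemma log_size_le_card:
  assumes "F \<subseteq> carrier M" and "finite F"
  shows "log_size F \<le> real (card F) * ln (real (card E))"
proof -
  have "card (trajectory A \<alpha> F E) \<le> card (F \<rightarrow>\<^sub>E E)"
    using assms E by (simp add: trajectory_PiE card_image_le finite_PiE)
  then have "card (trajectory A \<alpha> F E) \<le> card E ^ card F"
    using assms by (simp add: card_PiE)
  then have "real (card (trajectory A \<alpha> F E)) \<le> real (card E) ^ card F"
    by (metis of_nat_le_iff of_nat_power)
  moreover have "card E > 0" using E by (auto simp: card_gt_0_iff)
  ultimately show ?thesis
    using card_trajectory_ge_1[OF assms] unfolding log_size_def
    by (subst ln_realpow[symmetric]) auto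
qed

lemma trajectory_translate:
  assumes "K \<subseteq> carrier M" and s: "s \<in> carrier M"
  shows "trajectory A \<alpha> ((\<lambda>k. s \<otimes>\<^bsub>M\<^esub> k) ` K) E = \<alpha> s ` trajectory A \<alpha> K E"
proof -
  have "trajectory A \<alpha> ((\<lambda>k. s \<otimes>\<^bsub>M\<^esub> k) ` K) ((\<lambda>x. x) ` E) = \<alpha> s ` trajectory A \<alpha> K E"
  proof (rule trajectory_equivariant[OF A.comm_group_axioms A.comm_group_axioms act_hom[OF s]])
    show "inj_on (\<lambda>k. s \<otimes>\<^bsub>M\<^esub> k) K"
      using assms by (auto intro!: inj_onI dest: M.l_cancel)
    show "\<alpha> (s \<otimes>\<^bsub>M\<^esub> k) x = \<alpha> s (\<alpha> k x)" if "k \<in> K" "x \<in> E" for k x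
      using that assms E by (intro act_mult) auto
  qed (rule act_E[OF assms(1)])
  then show ?thesis by simp
qed

text \<open>Only an inequality, since \<alpha> at \<open>s\<close> may identify elements of the
  trajectory.\<close>

lemma log_size_translate:
  assumes "K \<subseteq> carrier M" and "finite K" and s: "s \<in> carrier M"
  shows "log_size ((\<lambda>k. s \<otimes>\<^bsub>M\<^esub> k) ` K) \<le> log_size K"
proof -
  have "card (trajectory A \<alpha> ((\<lambda>k. s \<otimes>\<^bsub>M\<^esub> k) ` K) E) \<le> card (trajectory A \<alpha> K E)"
    using assms by (simp add: trajectory_translate card_image_le finite_trajectory)
  moreover have "card (trajectory A \<alpha> ((\<lambda>k. s \<otimes>\<^bsub>M\<^esub> k) ` K) E) \<ge> 1"
    using assms by (intro card_trajectory_ge_1) auto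
  ultimately show ?thesis by (simp add: log_size_def)
qed

text \<open>Shearer's inequality for the set \<open>B\<close> of lightest representations:
  \<open>B\<close> is as large as the trajectory over \<open>V\<close>, its projections are no
  larger than the trajectories over the \<open>F i\<close>, and taking logarithms turns the product
  into a sum.\<close>

lemma log_size_cover:
  assumes V: "V \<subseteq> carrier M" "finite V" and I: "finite I" and k: "k > 0"
    and sub: "\<And>i. i \<in> I \<Longrightarrow> F i \<subseteq> V"
    and cov: "\<And>x. x \<in> V \<Longrightarrow> card {i \<in> I. x \<in> F i} = k"
  shows "real k * log_size V \<le> (\<Sum>i\<in>I. log_size (F i))"
proof -
  have "E \<noteq> {}" using E by auto
  obtain B where B: "B \<subseteq> V \<rightarrow>\<^sub>E E"
    and cB: "card B = card (trajectory A \<alpha> V E)"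
    and pB: "\<And>W. W \<subseteq> V \<Longrightarrow> card ((\<lambda>b. restrict b W) ` B) \<le> card (trajectory A \<alpha> W E)"
  proof (rule trajectory_section[OF A.comm_group_axioms V(2) E(1) \<open>E \<noteq> {}\<close>])
    show "\<alpha> s x \<in> carrier A" if "s \<in> V" "x \<in> E" for s x
      using act_E[OF V(1) that] .
  qed (rule that)
  have "finite B" using B V E by (meson finite_PiE finite_subset)
  have F: "F i \<subseteq> carrier M" "finite (F i)" if "i \<in> I" for i
    using sub[OF that] V finite_subset by auto
  have "(\<lambda>b. restrict b V) ` B = (\<lambda>b. b) ` B"
  proof (rule image_cong[OF refl])
    show "restrict b V = b" if "b \<in> B" for b
      using that B by (meson PiE_restrict subsetD)
  qed
  then have "real (card (trajectory A \<alpha> V E)) = real (card ((\<lambda>b. restrict b V) ` B))"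
    using cB by (simp only: image_ident)
  also have "\<dots> \<le> (\<Prod>i\<in>I. real (card ((\<lambda>b. restrict b (F i)) ` B))) powr (1 / k)"
    by (rule Shearer) (use V I k \<open>finite B\<close> cov in auto)
  also have "\<dots> \<le> (\<Prod>i\<in>I. real (card (trajectory A \<alpha> (F i) E))) powr (1 / k)"
  proof (rule powr_mono2)
    show "(\<Prod>i\<in>I. real (card ((\<lambda>b. restrict b (F i)) ` B))) \<le>
        (\<Prod>i\<in>I. real (card (trajectory A \<alpha> (F i) E)))"
      by (intro prod_mono conjI of_nat_0_le_iff of_nat_mono pB sub)
  qed (simp_all add: prod_nonneg)
  finally have "log_size V \<le> ln ((\<Prod>i\<in>I. real (card (trajectory A \<alpha> (F i) E))) powr (1 / k))"
    unfolding log_size_def by (rule ln_mono) (use card_trajectory_ge_1[OF V] in simp)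
  also have "\<dots> = 1 / k * (\<Sum>i\<in>I. log_size (F i))"
  proof -
    have "real (card (trajectory A \<alpha> (F i) E)) > 0" if "i \<in> I" for i
      using card_trajectory_ge_1[OF F[OF that]] by simp
    then show ?thesis unfolding log_size_def
      by (simp add: ln_powr ln_prod[OF I] less_imp_neq[symmetric])
  qed
  finally show ?thesis using k by (simp add: field_simps)
qed

text \<open>
  The translates \<open>s K\<close> with \<open>s \<in> F\<close> cover each point of \<open>F \<inter> \<Inter>k\<in>K. F k\<close>
  exactly \<open>card K\<close> times, because left and right cancellation make \<open>s\<close> and \<open>k\<close> determine each
  other in \<open>y = s k\<close>.
\<close>

lemma log_size_le_rate:
  assumes F: "F \<subseteq> carrier M" "finite F" and K: "K \<subseteq> carrier M" "finite K" "K \<noteq> {}"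
  shows "log_size F \<le> real (card F) * (log_size K / real (card K)) +
    (\<Sum>k\<in>K. real (card ((\<lambda>f. f \<otimes>\<^bsub>M\<^esub> k) ` F - F))) * ln (real (card E))"
proof -
  define R where "R k = (\<lambda>f. f \<otimes>\<^bsub>M\<^esub> k) ` F" for k
  define V where "V = F \<inter> (\<Inter>k\<in>K. R k)"
  have V: "V \<subseteq> F" "V \<subseteq> carrier M" "finite V" using F by (auto simp: V_def)
  have K0: "card K > 0" using K by (simp add: card_gt_0_iff)
  have cov: "card {s \<in> F. y \<in> (\<lambda>k. s \<otimes>\<^bsub>M\<^esub> k) ` K \<inter> V} = card K" if y: "y \<in> V" for y
  proof -
    have "\<exists>s\<in>F. y = s \<otimes>\<^bsub>M\<^esub> k" if "k \<in> K" for k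
      using y that by (auto simp: V_def R_def)
    \<comment> \<open>\<open>d k\<close> is the element of \<open>F\<close> which right
      multiplication by \<open>k\<close> sends to \<open>y\<close>; the map \<open>d\<close> matches
      \<open>K\<close> with the translates through \<open>y\<close>.\<close>
    then obtain d where d: "\<And>k. k \<in> K \<Longrightarrow> d k \<in> F \<and> y = d k \<otimes>\<^bsub>M\<^esub> k" by metis
    have cK: "k \<in> carrier M" "d k \<in> carrier M" if "k \<in> K" for k using that K F d by auto
    have "inj_on d K"
    proof (rule inj_onI)
      fix k k' assume "k \<in> K" "k' \<in> K" "d k = d k'"
      moreover from this have "d k \<otimes>\<^bsub>M\<^esub> k = d k \<otimes>\<^bsub>M\<^esub> k'" using d by metis
      ultimately show "k = k'" using M.l_cancel cK by blast
    qed
    moreover have "d ` K = {s \<in> F. y \<in> (\<lambda>k. s \<otimes>\<^bsub>M\<^esub> k) ` K \<inter> V}"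
    proof (intro equalityI subsetI)
      fix s assume "s \<in> {s \<in> F. y \<in> (\<lambda>k. s \<otimes>\<^bsub>M\<^esub> k) ` K \<inter> V}"
      then obtain k where k: "k \<in> K" "s \<in> F" "y = s \<otimes>\<^bsub>M\<^esub> k" by auto
      then have "s \<otimes>\<^bsub>M\<^esub> k = d k \<otimes>\<^bsub>M\<^esub> k" using d by metis
      then have "s = d k" using cK[OF k(1)] k(2) F M.r_cancel by blast
      then show "s \<in> d ` K" using k by blast
    qed (use d y in auto)
    ultimately show ?thesis by (metis card_image)
  qed
  have "real (card K) * log_size V \<le> (\<Sum>s\<in>F. log_size ((\<lambda>k. s \<otimes>\<^bsub>M\<^esub> k) ` K \<inter> V))"
    by (rule log_size_cover) (use V F K0 cov in auto)
  also have "\<dots> \<le> (\<Sum>s\<in>F. log_size K)"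
  proof (rule sum_mono)
    fix s assume "s \<in> F"
    then have s: "s \<in> carrier M" using F by auto
    have "log_size ((\<lambda>k. s \<otimes>\<^bsub>M\<^esub> k) ` K \<inter> V) \<le> log_size ((\<lambda>k. s \<otimes>\<^bsub>M\<^esub> k) ` K)"
      using K s by (intro log_size_mono) auto
    also have "\<dots> \<le> log_size K" using K s by (intro log_size_translate)
    finally show "log_size ((\<lambda>k. s \<otimes>\<^bsub>M\<^esub> k) ` K \<inter> V) \<le> log_size K" .
  qed
  finally have main: "log_size V \<le> real (card F) * (log_size K / real (card K))"
    using K0 by (simp add: field_simps)
  \<comment> \<open>A point of \<open>F\<close> outside \<open>V\<close> is missed by one of the
    translates \<open>R k\<close>, so the uncovered part is bounded by the Foelner defects of the
    elements of \<open>K\<close>.\<close>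
  have "card (F - V) \<le> (\<Sum>k\<in>K. card (F - R k))"
  proof -
    have "F - V = (\<Union>k\<in>K. F - R k)" by (auto simp: V_def)
    then show ?thesis using card_UN_le[OF K(2), of "\<lambda>k. F - R k"] by (simp only:)
  qed
  also have "\<dots> = (\<Sum>k\<in>K. card (R k - F))"
  proof (rule sum.cong[OF refl])
    show "card (F - R k) = card (R k - F)" if "k \<in> K" for k
      unfolding R_def using F K that by (intro M.card_Diff_right_translate) auto
  qed
  finally have "real (card (F - V)) \<le> (\<Sum>k\<in>K. real (card (R k - F)))"
    by (metis of_nat_le_iff of_nat_sum)
  moreover have "card E \<noteq> 0" using E by auto
  then have "ln (real (card E)) \<ge> 0" by simp
  ultimately have rest: "log_size (F - V) \<le> (\<Sum>k\<in>K. real (card (R k - F))) * ln (real (card E))"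
    using log_size_le_card[of "F - V"] F by (meson Diff_subset finite_Diff mult_right_mono order_trans)
  \<comment> \<open>Plain subadditivity is the covering inequality with multiplicity 1; the two
    disjoint pieces are indexed by the truth values.\<close>
  have "real 1 * log_size F \<le> (\<Sum>i\<in>{True, False}. log_size (if i then V else F - V))"
  proof (rule log_size_cover[OF F])
    show "card {i \<in> {True, False}. x \<in> (if i then V else F - V)} = 1" if "x \<in> F" for x
    proof -
      have "{i \<in> {True, False}. x \<in> (if i then V else F - V)} = {x \<in> V}" using that by auto
      then show ?thesis by simp
    qed
  qed (use V in auto)
  then show ?thesis using main rest unfolding R_def by simp
qed

text \<open>For right amenable \<open>M\<close> this is \<open>H_alg\<close> (see
  \<open>H_alg_eq_rate\<close>) in a form that mentions no net, so that two actions can be compared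
  one finite index set at a time.\<close>

definition rate :: real where
  "rate = (INF K\<in>{K. K \<subseteq> carrier M \<and> finite K \<and> K \<noteq> {}}. log_size K / real (card K))"

lemma rate_le:
  assumes "K \<subseteq> carrier M" "finite K" "K \<noteq> {}"
  shows "rate \<le> log_size K / real (card K)"
  unfolding rate_def
proof (rule cINF_lower)
  show "bdd_below ((\<lambda>K. log_size K / real (card K)) ` {K. K \<subseteq> carrier M \<and> finite K \<and> K \<noteq> {}})"
  proof (rule bdd_belowI2)
    fix K assume "K \<in> {K. K \<subseteq> carrier M \<and> finite K \<and> K \<noteq> {}}"
    then show "0 \<le> log_size K / real (card K)" by (simp add: log_size_nonneg)
  qed
qed (use assms in auto)

lemma rate_greatest:
  assumes "\<And>K. K \<subseteq> carrier M \<Longrightarrow> finite K \<Longrightarrow> K \<noteq> {} \<Longrightarrow> c \<le> log_size K / real (card K)"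
  shows "c \<le> rate"
  unfolding rate_def
proof (rule cINF_greatest)
  have "{\<one>\<^bsub>M\<^esub>} \<in> {K. K \<subseteq> carrier M \<and> finite K \<and> K \<noteq> {}}" by simp
  then show "{K. K \<subseteq> carrier M \<and> finite K \<and> K \<noteq> {}} \<noteq> {}" by blast
qed (use assms in auto)

text \<open>From below each \<open>F i\<close> itself competes in the infimum. From above fix one
  \<open>K\<close> with quotient less than \<open>c\<close>: by \<open>log_size_le_rate\<close> the
  quotient of \<open>F i\<close> exceeds that of \<open>K\<close> by at most a constant multiple of
  the summed Foelner defects \<open>b i\<close>, which tend to 0.\<close>

lemma tendsto_rate:
  assumes N: "right_folner_net M I r F"
  shows "((\<lambda>i. log_size (F i) / real (card (F i))) \<longlongrightarrow> rate) (tails I r)"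
proof (rule order_tendstoI)
  have F: "F i \<subseteq> carrier M" "finite (F i)" "F i \<noteq> {}" if "i \<in> I" for i
    using N that by (auto simp: right_folner_net_def)
  have D: "directed_preorder I r" using N by (simp add: right_folner_net_def)
  have I: "eventually (\<lambda>i. i \<in> I) (tails I r)"
    using D by (auto simp: eventually_tails[OF D] directed_preorder_def)
  fix c
  {
    assume "c < rate"
    show "eventually (\<lambda>i. c < log_size (F i) / real (card (F i))) (tails I r)"
      using I
    proof eventually_elim
      case (elim i)
      show ?case using \<open>c < rate\<close> rate_le[OF F[OF elim]] by linarith
    qed
  next
    assume "rate < c"
    then obtain K where K: "K \<subseteq> carrier M" "finite K" "K \<noteq> {}"
      and c: "log_size K / real (card K) < c"
      using rate_greatest[of c] by (meson not_le)
    define b where "b i = (\<Sum>k\<in>K. real (card ((\<lambda>f. f \<otimes>\<^bsub>M\<^esub> k) ` F i - F i)) / real (card (F i)))" for i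
    have "(b \<longlongrightarrow> (\<Sum>k\<in>K. 0)) (tails I r)"
      unfolding b_def using N K by (intro tendsto_sum) (auto simp: right_folner_net_def)
    then have "((\<lambda>i. log_size K / real (card K) + b i * ln (real (card E))) \<longlongrightarrow>
        log_size K / real (card K) + (\<Sum>k\<in>K. 0) * ln (real (card E))) (tails I r)"
      by (intro tendsto_intros)
    then have "eventually (\<lambda>i. log_size K / real (card K) + b i * ln (real (card E)) < c) (tails I r)"
      by (rule order_tendstoD) (simp add: c)
    with I show "eventually (\<lambda>i. log_size (F i) / real (card (F i)) < c) (tails I r)"
    proof eventually_elim
      case (elim i)
      have "card (F i) > 0" using F[OF elim(1)] by (simp add: card_gt_0_iff)
      then have "log_size (F i) / real (card (F i)) \<le> log_size K / real (card K) + b i * ln (real (card E))"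
        using log_size_le_rate[OF F(1,2)[OF elim(1)] K]
        unfolding b_def sum_divide_distrib[symmetric] by (simp add: field_simps)
      then show ?case using elim(2) by simp
    qed
  }
qed

text \<open>\<open>tendsto_rate\<close> gives the limit along every net at once; right amenability
  supplies one net, whose filter is non-trivial, and this pins down the number described by
  \<open>THE\<close>.\<close>

lemma H_alg_eq_rate:
  assumes "right_amenable M"
  shows "H_alg M A \<alpha> E = rate"
proof -
  obtain I :: "'m net_index set" and r F where N: "right_folner_net M I r F"
    using assms unfolding right_amenable_def by blast
  have "tails I r \<noteq> bot" using N tails_neq_bot by (auto simp: right_folner_net_def)
  then have uniq: "h = rate" if "((\<lambda>i. log_size (F i) / real (card (F i))) \<longlongrightarrow> h) (tails I r)" for h
    using tendsto_unique[OF _ that tendsto_rate[OF N]] by simp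
  show ?thesis
    unfolding H_alg_def log_size_def[symmetric]
  proof (rule the_equality)
    fix h
    assume "\<forall>(I :: 'm net_index set) r F. right_folner_net M I r F \<longrightarrow>
      ((\<lambda>i. log_size (F i) / real (card (F i))) \<longlongrightarrow> h) (tails I r)"
    then show "h = rate" using N by (intro uniq) simp
  qed (simp add: tendsto_rate)
qed

end

section \<open>Direct limits\<close>

locale direct_system =
  fixes I :: "'i set" and r :: "'i rel" and A :: "'i \<Rightarrow> ('a, 'c) monoid_scheme"
    and \<phi> :: "'i \<Rightarrow> 'i \<Rightarrow> 'a \<Rightarrow> 'a"
  assumes dir: "directed_preorder I r"
    and grp: "\<And>i. i \<in> I \<Longrightarrow> comm_group (A i)"
    and trans_hom: "\<And>i j. (i, j) \<in> r \<Longrightarrow> \<phi> i j \<in> hom (A i) (A j)"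
    and trans_id: "\<And>i x. i \<in> I \<Longrightarrow> x \<in> carrier (A i) \<Longrightarrow> \<phi> i i x = x"
    and trans_comp: "\<And>i j k x. (i, j) \<in> r \<Longrightarrow> (j, k) \<in> r \<Longrightarrow> x \<in> carrier (A i) \<Longrightarrow>
      \<phi> j k (\<phi> i j x) = \<phi> i k x"
begin

abbreviation "R \<equiv> dirlim_rel I r A \<phi>"
abbreviation "L \<equiv> dirlim I r A \<phi>"
abbreviation "D \<equiv> dirlim_map I r A \<phi>"

lemma index: "(i, j) \<in> r \<Longrightarrow> i \<in> I" "(i, j) \<in> r \<Longrightarrow> j \<in> I"
  using dir by (auto simp: directed_preorder_def preorder_on_def)

lemma le_refl: "i \<in> I \<Longrightarrow> (i, i) \<in> r"
  using dir by (auto simp: directed_preorder_def preorder_on_def refl_on_def)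

lemma le_trans: "(i, j) \<in> r \<Longrightarrow> (j, k) \<in> r \<Longrightarrow> (i, k) \<in> r"
  using dir by (auto simp: directed_preorder_def preorder_on_def dest: transD)

lemma upper_bound:
  assumes "i \<in> I" "j \<in> I"
  obtains k where "k \<in> I" "(i, k) \<in> r" "(j, k) \<in> r"
  using dir assms unfolding directed_preorder_def by blast

lemma trans_closed: "(i, j) \<in> r \<Longrightarrow> x \<in> carrier (A i) \<Longrightarrow> \<phi> i j x \<in> carrier (A j)"
  by (rule hom_in_carrier[OF trans_hom])

lemma trans_mult: "(i, j) \<in> r \<Longrightarrow> x \<in> carrier (A i) \<Longrightarrow> y \<in> carrier (A i) \<Longrightarrow>
    \<phi> i j (x \<otimes>\<^bsub>A i\<^esub> y) = \<phi> i j x \<otimes>\<^bsub>A j\<^esub> \<phi> i j y"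
  by (rule hom_mult[OF trans_hom])

lemma trans_one: "(i, j) \<in> r \<Longrightarrow> \<phi> i j \<one>\<^bsub>A i\<^esub> = \<one>\<^bsub>A j\<^esub>"
  by (rule hom_one[OF trans_hom comm_group.axioms(2)[OF grp] comm_group.axioms(2)[OF grp]])
    (auto dest: index)

lemma closed:
  assumes "i \<in> I"
  shows "\<one>\<^bsub>A i\<^esub> \<in> carrier (A i)"
    and "x \<in> carrier (A i) \<Longrightarrow> y \<in> carrier (A i) \<Longrightarrow> x \<otimes>\<^bsub>A i\<^esub> y \<in> carrier (A i)"
proof -
  interpret comm_group "A i" by (rule grp[OF assms])
  show "\<one>\<^bsub>A i\<^esub> \<in> carrier (A i)" by simp
  show "x \<in> carrier (A i) \<Longrightarrow> y \<in> carrier (A i) \<Longrightarrow> x \<otimes>\<^bsub>A i\<^esub> y \<in> carrier (A i)" by simp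
qed

lemma rel_iff: "((i, x), (j, y)) \<in> R \<longleftrightarrow> i \<in> I \<and> x \<in> carrier (A i) \<and> j \<in> I \<and> y \<in> carrier (A j) \<and>
    (\<exists>k. (i, k) \<in> r \<and> (j, k) \<in> r \<and> \<phi> i k x = \<phi> j k y)"
  using index by (auto simp: dirlim_rel_def)

lemma equiv_rel: "equiv (SIGMA i:I. carrier (A i)) R"
proof (rule equivI)
  show "R \<subseteq> (SIGMA i:I. carrier (A i)) \<times> (SIGMA i:I. carrier (A i))"
    by (auto simp: dirlim_rel_def)
  show "refl_on (SIGMA i:I. carrier (A i)) R"
    by (auto simp: refl_on_def rel_iff intro: le_refl)
  show "sym R"
    by (rule symI) (force simp: rel_iff)
  show "trans R"
  proof (rule transI, clarify)
    fix i x j y l z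
    assume 1: "((i, x), (j, y)) \<in> R" and 2: "((j, y), (l, z)) \<in> R"
    obtain k where k: "(i, k) \<in> r" "(j, k) \<in> r" "\<phi> i k x = \<phi> j k y"
      using 1 by (auto simp: rel_iff)
    obtain m where m: "(j, m) \<in> r" "(l, m) \<in> r" "\<phi> j m y = \<phi> l m z"
      using 2 by (auto simp: rel_iff)
    \<comment> \<open>Above both witnesses \<open>k\<close> and \<open>m\<close> all three elements
      have the same image.\<close>
    obtain n where n: "(k, n) \<in> r" "(m, n) \<in> r" using upper_bound index k m by metis
    have c: "x \<in> carrier (A i)" "y \<in> carrier (A j)" "z \<in> carrier (A l)"
      using 1 2 by (auto simp: rel_iff)
    have "\<phi> i n x = \<phi> k n (\<phi> j k y)" using trans_comp[OF k(1) n(1) c(1)] k(3) by simp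
    also have "\<dots> = \<phi> m n (\<phi> l m z)"
      using trans_comp[OF k(2) n(1) c(2)] trans_comp[OF m(1) n(2) c(2)] m(3) by simp
    also have "\<dots> = \<phi> l n z" using trans_comp[OF m(2) n(2) c(3)] .
    finally show "((i, x), (l, z)) \<in> R"
      using 1 2 le_trans[OF k(1) n(1)] le_trans[OF m(2) n(2)] by (auto simp: rel_iff)
  qed
qed

lemma mem_map: "(j, y) \<in> D i x \<longleftrightarrow> ((i, x), (j, y)) \<in> R"
  by (simp add: dirlim_map_def)

lemma map_eq_iff:
  assumes "i \<in> I" "x \<in> carrier (A i)" "j \<in> I" "y \<in> carrier (A j)"
  shows "D i x = D j y \<longleftrightarrow> (\<exists>k. (i, k) \<in> r \<and> (j, k) \<in> r \<and> \<phi> i k x = \<phi> j k y)"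
proof -
  have "D i x = D j y \<longleftrightarrow> ((i, x), (j, y)) \<in> R"
    unfolding dirlim_map_def using assms by (intro eq_equiv_class_iff[OF equiv_rel]) auto
  then show ?thesis using assms by (simp add: rel_iff)
qed

lemma map_trans:
  assumes "(i, k) \<in> r" "x \<in> carrier (A i)"
  shows "D k (\<phi> i k x) = D i x"
proof -
  have "i \<in> I" "k \<in> I" using assms index by blast+
  then show ?thesis
    using assms trans_closed by (subst map_eq_iff) (auto intro!: exI[of _ k] le_refl simp: trans_id)
qed

lemma carrier_dirlim: "carrier L = (\<Union>i\<in>I. D i ` carrier (A i))"
  by (auto simp: dirlim_def dirlim_map_def quotient_def)

lemma map_closed: "i \<in> I \<Longrightarrow> x \<in> carrier (A i) \<Longrightarrow> D i x \<in> carrier L"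
  by (auto simp: carrier_dirlim)

text \<open>Directedness brings two classes to one index, which reduces laws of the limit to laws of
  a single group \<open>A k\<close>.\<close>

lemma common_index:
  assumes "P \<in> carrier L" "Q \<in> carrier L"
  obtains k x y where "k \<in> I" "x \<in> carrier (A k)" "y \<in> carrier (A k)" "P = D k x" "Q = D k y"
proof -
  obtain i x where x: "i \<in> I" "x \<in> carrier (A i)" "P = D i x" using assms by (auto simp: carrier_dirlim)
  obtain j y where y: "j \<in> I" "y \<in> carrier (A j)" "Q = D j y" using assms by (auto simp: carrier_dirlim)
  obtain k where k: "k \<in> I" "(i, k) \<in> r" "(j, k) \<in> r" by (rule upper_bound[OF x(1) y(1)])
  show thesis
    by (rule that[of k "\<phi> i k x" "\<phi> j k y"]) (simp_all add: k x y trans_closed map_trans)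
qed

text \<open>The product in the limit is a union over all representatives and all upper bounds of
  their indices. It is well defined because every member of this family is the same class.\<close>

lemma map_mult:
  assumes k: "k \<in> I" and x: "x \<in> carrier (A k)" and y: "y \<in> carrier (A k)"
  shows "D k x \<otimes>\<^bsub>L\<^esub> D k y = D k (x \<otimes>\<^bsub>A k\<^esub> y)"
proof -
  let ?S = "{D l (\<phi> i l x' \<otimes>\<^bsub>A l\<^esub> \<phi> j l y') | i x' j y' l.
      (i, x') \<in> D k x \<and> (j, y') \<in> D k y \<and> l \<in> I \<and> (i, l) \<in> r \<and> (j, l) \<in> r}"
  have "?S = {D k (x \<otimes>\<^bsub>A k\<^esub> y)}"
  proof (intro equalityI subsetI)
    fix Z assume "Z \<in> ?S"
    then obtain i x' j y' l where Z: "Z = D l (\<phi> i l x' \<otimes>\<^bsub>A l\<^esub> \<phi> j l y')"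
      and x': "((k, x), (i, x')) \<in> R" and y': "((k, y), (j, y')) \<in> R"
      and l: "l \<in> I" "(i, l) \<in> r" "(j, l) \<in> r"
      by (auto simp: mem_map)
    obtain m where m: "(k, m) \<in> r" "(i, m) \<in> r" "\<phi> k m x = \<phi> i m x'"
      using x' by (auto simp: rel_iff)
    obtain n where n: "(k, n) \<in> r" "(j, n) \<in> r" "\<phi> k n y = \<phi> j n y'"
      using y' by (auto simp: rel_iff)
    \<comment> \<open>The index \<open>q\<close> lies above \<open>l\<close>, \<open>m\<close> and
      \<open>n\<close>, so there \<open>x'\<close> agrees with \<open>x\<close> and
      \<open>y'\<close> with \<open>y\<close>.\<close>
    obtain p where p: "(l, p) \<in> r" "(m, p) \<in> r" using upper_bound index l m by metis
    obtain q where q: "(p, q) \<in> r" "(n, q) \<in> r" using upper_bound index p n by metis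
    have c: "x' \<in> carrier (A i)" "y' \<in> carrier (A j)" using x' y' by (auto simp: rel_iff)
    note lq = le_trans[OF p(1) q(1)] and mq = le_trans[OF p(2) q(1)]
    have "Z = D q (\<phi> l q (\<phi> i l x' \<otimes>\<^bsub>A l\<^esub> \<phi> j l y'))"
      unfolding Z using lq c l by (intro map_trans[symmetric] closed trans_closed)
    also have "\<phi> l q (\<phi> i l x' \<otimes>\<^bsub>A l\<^esub> \<phi> j l y') = \<phi> l q (\<phi> i l x') \<otimes>\<^bsub>A q\<^esub> \<phi> l q (\<phi> j l y')"
      using lq c l by (intro trans_mult trans_closed)
    also have "\<phi> l q (\<phi> i l x') = \<phi> k q x"
      using trans_comp[OF l(2) lq c(1)] trans_comp[OF m(2) mq c(1)] trans_comp[OF m(1) mq x] m(3) by simp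
    also have "\<phi> l q (\<phi> j l y') = \<phi> k q y"
      using trans_comp[OF l(3) lq c(2)] trans_comp[OF n(2) q(2) c(2)] trans_comp[OF n(1) q(2) y] n(3) by simp
    also have "\<phi> k q x \<otimes>\<^bsub>A q\<^esub> \<phi> k q y = \<phi> k q (x \<otimes>\<^bsub>A k\<^esub> y)"
      using le_trans[OF n(1) q(2)] x y by (intro trans_mult[symmetric])
    also have "D q \<dots> = D k (x \<otimes>\<^bsub>A k\<^esub> y)"
      using le_trans[OF n(1) q(2)] x y k by (intro map_trans closed)
    finally show "Z \<in> {D k (x \<otimes>\<^bsub>A k\<^esub> y)}" by simp
  next
    fix Z assume "Z \<in> {D k (x \<otimes>\<^bsub>A k\<^esub> y)}"
    then have "Z = D k (\<phi> k k x \<otimes>\<^bsub>A k\<^esub> \<phi> k k y)" using k x y by (simp add: trans_id)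
    moreover have "(k, x) \<in> D k x" "(k, y) \<in> D k y"
      using k x y le_refl by (auto simp: mem_map rel_iff)
    ultimately show "Z \<in> ?S" using k le_refl by blast
  qed
  moreover have "D k x \<otimes>\<^bsub>L\<^esub> D k y = \<Union>?S" by (simp add: dirlim_def)
  ultimately show ?thesis by simp
qed

text \<open>The unit of the limit is a union over all indices; the classes in it coincide, since at
  an upper bound both identities become the identity.\<close>

lemma map_one:
  assumes "i \<in> I"
  shows "D i \<one>\<^bsub>A i\<^esub> = \<one>\<^bsub>L\<^esub>"
proof -
  have "D j \<one>\<^bsub>A j\<^esub> = D i \<one>\<^bsub>A i\<^esub>" if j: "j \<in> I" for j
  proof -
    obtain k where k: "(i, k) \<in> r" "(j, k) \<in> r" by (rule upper_bound[OF assms j])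
    show ?thesis
      using map_trans[OF k(1) closed(1)[OF assms]] map_trans[OF k(2) closed(1)[OF j]]
      by (simp add: trans_one[OF k(1)] trans_one[OF k(2)])
  qed
  then have "(\<Union>j\<in>I. D j \<one>\<^bsub>A j\<^esub>) = D i \<one>\<^bsub>A i\<^esub>" using assms by blast
  then show ?thesis by (simp add: dirlim_def)
qed

lemma comm_group_dirlim: "comm_group L"
proof (rule comm_groupI)
  show "P \<otimes>\<^bsub>L\<^esub> Q \<in> carrier L" if "P \<in> carrier L" "Q \<in> carrier L" for P Q
    by (rule common_index[OF that]) (simp add: map_mult map_closed closed)
  obtain i where "i \<in> I" using dir by (auto simp: directed_preorder_def)
  then show "\<one>\<^bsub>L\<^esub> \<in> carrier L" using map_closed[OF _ closed(1)] by (simp add: map_one[symmetric])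
  show "P \<otimes>\<^bsub>L\<^esub> Q = Q \<otimes>\<^bsub>L\<^esub> P" if "P \<in> carrier L" "Q \<in> carrier L" for P Q
  proof (rule common_index[OF that])
    fix k x y assume k: "k \<in> I" "x \<in> carrier (A k)" "y \<in> carrier (A k)" "P = D k x" "Q = D k y"
    interpret comm_group "A k" using grp k by blast
    show ?thesis using k by (simp add: map_mult m_comm)
  qed
  fix P assume P: "P \<in> carrier L"
  then obtain k x where k: "k \<in> I" "x \<in> carrier (A k)" "P = D k x" by (auto simp: carrier_dirlim)
  interpret comm_group "A k" using grp k by blast
  show "\<one>\<^bsub>L\<^esub> \<otimes>\<^bsub>L\<^esub> P = P"
    using k by (simp add: map_one[OF k(1), symmetric] map_mult)
  show "\<exists>Q\<in>carrier L. Q \<otimes>\<^bsub>L\<^esub> P = \<one>\<^bsub>L\<^esub>"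
    using k by (intro bexI[of _ "D k (inv\<^bsub>A k\<^esub> x)"]) (simp_all add: map_mult map_one map_closed)
next
  fix P Q U assume P: "P \<in> carrier L" and QU: "Q \<in> carrier L" "U \<in> carrier L"
  obtain j y z where j: "j \<in> I" "y \<in> carrier (A j)" "z \<in> carrier (A j)" "Q = D j y" "U = D j z"
    by (rule common_index[OF QU])
  obtain i x where i: "i \<in> I" "x \<in> carrier (A i)" "P = D i x"
    using P by (auto simp: carrier_dirlim)
  \<comment> \<open>Two of the three elements already share the index \<open>j\<close>; a further
    upper bound brings in the third.\<close>
  obtain k where k: "k \<in> I" "(i, k) \<in> r" "(j, k) \<in> r" by (rule upper_bound[OF i(1) j(1)])
  have PQU: "P = D k (\<phi> i k x)" "Q = D k (\<phi> j k y)" "U = D k (\<phi> j k z)"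
    using i j k by (simp_all add: map_trans)
  interpret comm_group "A k" using grp k by blast
  show "P \<otimes>\<^bsub>L\<^esub> Q \<otimes>\<^bsub>L\<^esub> U = P \<otimes>\<^bsub>L\<^esub> (Q \<otimes>\<^bsub>L\<^esub> U)"
    unfolding PQU using i j k by (simp add: trans_closed map_mult m_assoc)
qed

lemma map_hom: "i \<in> I \<Longrightarrow> D i \<in> hom (A i) L"
  by (rule homI) (simp_all add: map_mult map_closed)

end

section \<open>Ore localization\<close>

locale ore_localization = S: monoid_cancel S + G: group G + A: comm_group A
  for S :: "('s, 'b) monoid_scheme" and G :: "('g, 'd) monoid_scheme" and \<iota> :: "'s \<Rightarrow> 'g"
    and A :: "('a, 'c) monoid_scheme" and \<Lambda> :: "'s \<Rightarrow> 'a \<Rightarrow> 'a" +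
  assumes fractions: "group_of_left_fractions S G \<iota>"
    and act: "left_action S A \<Lambda>"
begin

section \<open>The embedding into the group of fractions and the left Ore condition\<close>

lemma emb_closed [simp]: "s \<in> carrier S \<Longrightarrow> \<iota> s \<in> carrier G"
  using fractions hom_in_carrier by (fastforce simp: group_of_left_fractions_def)

lemma emb_mult: "s \<in> carrier S \<Longrightarrow> t \<in> carrier S \<Longrightarrow> \<iota> (s \<otimes>\<^bsub>S\<^esub> t) = \<iota> s \<otimes>\<^bsub>G\<^esub> \<iota> t"
  using fractions by (simp add: group_of_left_fractions_def hom_def)

lemma emb_one: "\<iota> \<one>\<^bsub>S\<^esub> = \<one>\<^bsub>G\<^esub>"
  using fractions by (simp add: group_of_left_fractions_def)

lemma emb_inj: "inj_on \<iota> (carrier S)"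
  using fractions by (simp add: group_of_left_fractions_def)

lemma fractionE:
  assumes "g \<in> carrier G"
  obtains s t where "s \<in> carrier S" "t \<in> carrier S" "g = inv\<^bsub>G\<^esub> \<iota> s \<otimes>\<^bsub>G\<^esub> \<iota> t"
  using fractions assms unfolding group_of_left_fractions_def by blast

text \<open>Rewrite the right fraction of \<open>s\<close> by \<open>t\<close> as a left fraction of
  \<open>b\<close> by \<open>a\<close>, clear both denominators in the group, and return to
  \<open>S\<close> by injectivity of \<iota>.\<close>

lemma left_ore:
  assumes s: "s \<in> carrier S" and t: "t \<in> carrier S"
  obtains a b where "a \<in> carrier S" "b \<in> carrier S" "a \<otimes>\<^bsub>S\<^esub> s = b \<otimes>\<^bsub>S\<^esub> t"
proof -
  have "\<iota> s \<otimes>\<^bsub>G\<^esub> inv\<^bsub>G\<^esub> \<iota> t \<in> carrier G" using s t by simp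
  then obtain a b where ab: "a \<in> carrier S" "b \<in> carrier S"
    and eq: "\<iota> s \<otimes>\<^bsub>G\<^esub> inv\<^bsub>G\<^esub> \<iota> t = inv\<^bsub>G\<^esub> \<iota> a \<otimes>\<^bsub>G\<^esub> \<iota> b"
    by (rule fractionE)
  have "\<iota> a \<otimes>\<^bsub>G\<^esub> \<iota> s = \<iota> a \<otimes>\<^bsub>G\<^esub> (\<iota> s \<otimes>\<^bsub>G\<^esub> inv\<^bsub>G\<^esub> \<iota> t) \<otimes>\<^bsub>G\<^esub> \<iota> t"
    using s t ab by (simp add: G.m_assoc)
  also have "\<dots> = \<iota> b \<otimes>\<^bsub>G\<^esub> \<iota> t"
    unfolding eq using s t ab by (simp add: G.m_assoc[symmetric])
  finally have "\<iota> (a \<otimes>\<^bsub>S\<^esub> s) = \<iota> (b \<otimes>\<^bsub>S\<^esub> t)" using s t ab by (simp add: emb_mult)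
  then show thesis using that ab s t inj_onD[OF emb_inj] by blast
qed

lemma act_hom: "s \<in> carrier S \<Longrightarrow> \<Lambda> s \<in> hom A A"
  using act by (simp add: left_action_def)

lemma act_closed [simp]: "s \<in> carrier S \<Longrightarrow> x \<in> carrier A \<Longrightarrow> \<Lambda> s x \<in> carrier A"
  by (rule hom_in_carrier[OF act_hom])

lemma act_add: "s \<in> carrier S \<Longrightarrow> x \<in> carrier A \<Longrightarrow> y \<in> carrier A \<Longrightarrow>
    \<Lambda> s (x \<otimes>\<^bsub>A\<^esub> y) = \<Lambda> s x \<otimes>\<^bsub>A\<^esub> \<Lambda> s y"
  by (rule hom_mult[OF act_hom])

lemma act_zero [simp]: "s \<in> carrier S \<Longrightarrow> \<Lambda> s \<one>\<^bsub>A\<^esub> = \<one>\<^bsub>A\<^esub>"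
  by (rule hom_one[OF act_hom A.group_axioms A.group_axioms])

lemma act_mult: "s \<in> carrier S \<Longrightarrow> t \<in> carrier S \<Longrightarrow> x \<in> carrier A \<Longrightarrow>
    \<Lambda> (s \<otimes>\<^bsub>S\<^esub> t) x = \<Lambda> s (\<Lambda> t x)"
  using act by (simp add: left_action_def)

lemma act_unit: "x \<in> carrier A \<Longrightarrow> \<Lambda> \<one>\<^bsub>S\<^esub> x = x"
  using act by (simp add: left_action_def)

section \<open>The kernel of the action and the induced action on the quotient\<close>

abbreviation "N \<equiv> action_kernel S A \<Lambda>"
abbreviation "Q \<equiv> reduced_group S A \<Lambda>"

lemma kernel_iff: "x \<in> N \<longleftrightarrow> x \<in> carrier A \<and> (\<exists>s\<in>carrier S. \<Lambda> s x = \<one>\<^bsub>A\<^esub>)"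
  by (auto simp: action_kernel_def kernel_def)

text \<open>The left Ore condition makes the kernels of the \<open>\<Lambda> s\<close> directed.\<close>

lemma common_annihilator:
  assumes s: "s \<in> carrier S" "x \<in> carrier A" "\<Lambda> s x = \<Lambda> s x'" "x' \<in> carrier A"
    and t: "t \<in> carrier S" "y \<in> carrier A" "\<Lambda> t y = \<Lambda> t y'" "y' \<in> carrier A"
  obtains u where "u \<in> carrier S" "\<Lambda> u x = \<Lambda> u x'" "\<Lambda> u y = \<Lambda> u y'"
proof -
  obtain a b where ab: "a \<in> carrier S" "b \<in> carrier S" "a \<otimes>\<^bsub>S\<^esub> s = b \<otimes>\<^bsub>S\<^esub> t"
    by (rule left_ore[OF s(1) t(1)])
  have 1: "\<Lambda> (a \<otimes>\<^bsub>S\<^esub> s) x = \<Lambda> (a \<otimes>\<^bsub>S\<^esub> s) x'" using s ab(1) by (simp add: act_mult)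
  have 2: "\<Lambda> (a \<otimes>\<^bsub>S\<^esub> s) y = \<Lambda> (a \<otimes>\<^bsub>S\<^esub> s) y'"
    unfolding ab(3) using t ab(2) by (simp add: act_mult)
  show thesis by (rule that[OF _ 1 2]) (use ab(1) s(1) in simp)
qed

lemma subgroup_kernel: "subgroup N A"
proof (rule A.subgroupI)
  show "N \<subseteq> carrier A" by (auto simp: kernel_iff)
  have "\<one>\<^bsub>A\<^esub> \<in> N" unfolding kernel_iff by (auto intro!: bexI[of _ "\<one>\<^bsub>S\<^esub>"])
  then show "N \<noteq> {}" by blast
  show "inv\<^bsub>A\<^esub> x \<in> N" if x: "x \<in> N" for x
  proof -
    obtain s where s: "s \<in> carrier S" "x \<in> carrier A" "\<Lambda> s x = \<one>\<^bsub>A\<^esub>"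
      using x by (auto simp: kernel_iff)
    interpret h: group_hom A A "\<Lambda> s"
      using act_hom[OF s(1)] by unfold_locales
    have "\<Lambda> s (inv\<^bsub>A\<^esub> x) = \<one>\<^bsub>A\<^esub>" "inv\<^bsub>A\<^esub> x \<in> carrier A" using s by simp_all
    then show ?thesis using s(1) unfolding kernel_iff by blast
  qed
  show "x \<otimes>\<^bsub>A\<^esub> y \<in> N" if xy: "x \<in> N" "y \<in> N" for x y
  proof -
    obtain s t where st: "s \<in> carrier S" "x \<in> carrier A" "\<Lambda> s x = \<one>\<^bsub>A\<^esub>"
      "t \<in> carrier S" "y \<in> carrier A" "\<Lambda> t y = \<one>\<^bsub>A\<^esub>"
      using xy by (auto simp: kernel_iff)
    \<comment> \<open>To be annihilated means to agree with the identity, so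
      \<open>common_annihilator\<close> is used with the identity as second element of both
      pairs.\<close>
    obtain u where u: "u \<in> carrier S" "\<Lambda> u x = \<Lambda> u \<one>\<^bsub>A\<^esub>" "\<Lambda> u y = \<Lambda> u \<one>\<^bsub>A\<^esub>"
      by (rule common_annihilator[of s x "\<one>\<^bsub>A\<^esub>" t y "\<one>\<^bsub>A\<^esub>"]) (simp_all add: st)
    have "\<Lambda> u (x \<otimes>\<^bsub>A\<^esub> y) = \<one>\<^bsub>A\<^esub>" using u st by (simp add: act_add)
    then show ?thesis using u(1) st(2,5) A.m_closed unfolding kernel_iff by blast
  qed
qed

lemma normal_kernel: "N \<lhd> A"
  using subgroup_kernel by (simp add: A.normal_iff_subgroup)

text \<open>If \<open>t\<close> annihilates \<open>x\<close>, the Ore condition gives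
  \<open>a\<close> and \<open>b\<close> with \<open>a s = b t\<close>, so \<open>a\<close>
  annihilates the image of \<open>x\<close> under \<open>s\<close>.\<close>

lemma act_kernel:
  assumes s: "s \<in> carrier S" and x: "x \<in> N"
  shows "\<Lambda> s x \<in> N"
proof -
  obtain t where t: "t \<in> carrier S" "x \<in> carrier A" "\<Lambda> t x = \<one>\<^bsub>A\<^esub>"
    using x by (auto simp: kernel_iff)
  obtain a b where ab: "a \<in> carrier S" "b \<in> carrier S" "a \<otimes>\<^bsub>S\<^esub> s = b \<otimes>\<^bsub>S\<^esub> t"
    by (rule left_ore[OF s t(1)])
  have "\<Lambda> a (\<Lambda> s x) = \<Lambda> b (\<Lambda> t x)"
    using s t(1,2) ab by (simp add: act_mult[symmetric])
  then show ?thesis using s t ab by (auto simp: kernel_iff)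
qed

text \<open>The two elements differ by an element of the kernel, and whatever annihilates that
  difference identifies them.\<close>

lemma coset_eqD:
  assumes x: "x \<in> carrier A" and y: "y \<in> carrier A" and eq: "N #>\<^bsub>A\<^esub> x = N #>\<^bsub>A\<^esub> y"
  obtains s where "s \<in> carrier S" "\<Lambda> s x = \<Lambda> s y"
proof -
  have "x \<in> N #>\<^bsub>A\<^esub> y" using A.rcos_self[OF x subgroup_kernel] eq by simp
  then obtain n where n: "n \<in> N" "x = n \<otimes>\<^bsub>A\<^esub> y" by (auto simp: r_coset_def)
  then obtain s where "s \<in> carrier S" "n \<in> carrier A" "\<Lambda> s n = \<one>\<^bsub>A\<^esub>" by (auto simp: kernel_iff)
  then show thesis using that[of s] n y by (simp add: act_add)
qed

lemma comm_group_reduced: "comm_group Q"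
  by (rule A.abelian_FactGroup[OF subgroup_kernel])

lemma carrier_reduced: "carrier Q = (\<lambda>x. N #>\<^bsub>A\<^esub> x) ` carrier A"
  by (rule carrier_FactGroup)

lemma coset_hom: "(\<lambda>x. N #>\<^bsub>A\<^esub> x) \<in> hom A Q"
  by (rule normal.r_coset_hom_Mod[OF normal_kernel])

text \<open>The induced action is a union over all representatives of the coset; invariance of the
  kernel makes each of them contribute the same coset.\<close>

lemma reduced_action_coset:
  assumes s: "s \<in> carrier S" and x: "x \<in> carrier A"
  shows "reduced_action S A \<Lambda> s (N #>\<^bsub>A\<^esub> x) = N #>\<^bsub>A\<^esub> \<Lambda> s x"
proof -
  have "N #>\<^bsub>A\<^esub> \<Lambda> s y = N #>\<^bsub>A\<^esub> \<Lambda> s x" if "y \<in> N #>\<^bsub>A\<^esub> x" for y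
  proof -
    obtain n where n: "n \<in> N" "y = n \<otimes>\<^bsub>A\<^esub> x" using \<open>y \<in> N #>\<^bsub>A\<^esub> x\<close> by (auto simp: r_coset_def)
    then have "n \<in> carrier A" by (simp add: kernel_iff)
    then have *: "\<Lambda> s y \<in> N #>\<^bsub>A\<^esub> \<Lambda> s x"
      using n act_kernel[OF s n(1)] s x by (auto simp: act_add r_coset_def)
    show ?thesis by (rule A.repr_independence[OF * _ subgroup_kernel, symmetric]) (use s x in simp)
  qed
  moreover have "x \<in> N #>\<^bsub>A\<^esub> x" by (rule A.rcos_self[OF x subgroup_kernel])
  ultimately show ?thesis unfolding reduced_action_def by blast
qed

lemma reduced_action_hom:
  assumes s: "s \<in> carrier S"
  shows "reduced_action S A \<Lambda> s \<in> hom Q Q"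
proof (rule homI)
  show "reduced_action S A \<Lambda> s C \<in> carrier Q" if "C \<in> carrier Q" for C
    using that s by (auto simp: carrier_reduced reduced_action_coset)
  fix C C' assume "C \<in> carrier Q" "C' \<in> carrier Q"
  then obtain x y where xy: "x \<in> carrier A" "y \<in> carrier A" "C = N #>\<^bsub>A\<^esub> x" "C' = N #>\<^bsub>A\<^esub> y"
    by (auto simp: carrier_reduced)
  have "C \<otimes>\<^bsub>Q\<^esub> C' = N #>\<^bsub>A\<^esub> (x \<otimes>\<^bsub>A\<^esub> y)" unfolding xy using xy by (intro hom_mult[OF coset_hom, symmetric])
  moreover have "(N #>\<^bsub>A\<^esub> \<Lambda> s x) \<otimes>\<^bsub>Q\<^esub> (N #>\<^bsub>A\<^esub> \<Lambda> s y) = N #>\<^bsub>A\<^esub> (\<Lambda> s x \<otimes>\<^bsub>A\<^esub> \<Lambda> s y)"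
    using xy s by (intro hom_mult[OF coset_hom, symmetric]) auto
  ultimately show "reduced_action S A \<Lambda> s (C \<otimes>\<^bsub>Q\<^esub> C') =
      reduced_action S A \<Lambda> s C \<otimes>\<^bsub>Q\<^esub> reduced_action S A \<Lambda> s C'"
    using xy s by (simp add: reduced_action_coset act_add del: mult_FactGroup)
qed

section \<open>Fractions as the index set of a direct system\<close>

abbreviation "r \<equiv> fraction_preorder S G \<iota>"
abbreviation "L \<equiv> ore_group S G \<iota> A \<Lambda>"

lemma preorder_iff:
  "(g, h) \<in> r \<longleftrightarrow> g \<in> carrier G \<and> h \<in> carrier G \<and> (\<exists>s\<in>carrier S. g = h \<otimes>\<^bsub>G\<^esub> \<iota> s)"
proof -
  have "inv\<^bsub>G\<^esub> h \<otimes>\<^bsub>G\<^esub> g = \<iota> s \<longleftrightarrow> g = h \<otimes>\<^bsub>G\<^esub> \<iota> s"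
    if "g \<in> carrier G" "h \<in> carrier G" "s \<in> carrier S" for s
    using that G.inv_solve_left'[of "\<iota> s" h g] by simp
  then show ?thesis unfolding fraction_preorder_def by (auto simp: image_iff)
qed

text \<open>Directedness is the existence of common denominators: if \<open>a\<close> and
  \<open>c\<close> are the denominators of \<open>g\<close> and \<open>h\<close> and
  \<open>p a = q c\<close> by the Ore condition, then the inverse of \<open>p a\<close> is an upper
  bound of both.\<close>

lemma directed_preorder_fractions: "directed_preorder (carrier G) r"
  unfolding directed_preorder_def preorder_on_def
proof (intro conjI ballI)
  show "carrier G \<noteq> {}" by blast
  show "r \<subseteq> carrier G \<times> carrier G" by (auto simp: preorder_iff)
  show "refl_on (carrier G) r"
    by (auto simp: refl_on_def preorder_iff emb_one intro!: bexI[of _ "\<one>\<^bsub>S\<^esub>"])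
  show "trans r"
  proof (rule transI)
    fix g h k assume "(g, h) \<in> r" "(h, k) \<in> r"
    then obtain s t where "g = h \<otimes>\<^bsub>G\<^esub> \<iota> s" "h = k \<otimes>\<^bsub>G\<^esub> \<iota> t" "s \<in> carrier S" "t \<in> carrier S"
      "k \<in> carrier G" by (auto simp: preorder_iff)
    then show "(g, k) \<in> r"
      by (auto simp: preorder_iff emb_mult G.m_assoc intro!: bexI[of _ "t \<otimes>\<^bsub>S\<^esub> s"])
  qed
  fix g h assume gh: "g \<in> carrier G" "h \<in> carrier G"
  obtain a b where ab: "a \<in> carrier S" "b \<in> carrier S" "g = inv\<^bsub>G\<^esub> \<iota> a \<otimes>\<^bsub>G\<^esub> \<iota> b"
    by (rule fractionE[OF gh(1)])
  obtain c d where cd: "c \<in> carrier S" "d \<in> carrier S" "h = inv\<^bsub>G\<^esub> \<iota> c \<otimes>\<^bsub>G\<^esub> \<iota> d"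
    by (rule fractionE[OF gh(2)])
  obtain p q where pq: "p \<in> carrier S" "q \<in> carrier S" "p \<otimes>\<^bsub>S\<^esub> a = q \<otimes>\<^bsub>S\<^esub> c"
    by (rule left_ore[OF ab(1) cd(1)])
  have cancel: "inv\<^bsub>G\<^esub> \<iota> u \<otimes>\<^bsub>G\<^esub> \<iota> v = inv\<^bsub>G\<^esub> \<iota> (w \<otimes>\<^bsub>S\<^esub> u) \<otimes>\<^bsub>G\<^esub> \<iota> (w \<otimes>\<^bsub>S\<^esub> v)"
    if "u \<in> carrier S" "v \<in> carrier S" "w \<in> carrier S" for u v w
  proof -
    have "inv\<^bsub>G\<^esub> \<iota> w \<otimes>\<^bsub>G\<^esub> (\<iota> w \<otimes>\<^bsub>G\<^esub> \<iota> v) = \<iota> v"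
      using that by (simp add: G.m_assoc[symmetric])
    then show ?thesis using that by (simp add: emb_mult G.inv_mult_group G.m_assoc)
  qed
  let ?k = "inv\<^bsub>G\<^esub> \<iota> (p \<otimes>\<^bsub>S\<^esub> a)"
  have k: "?k \<in> carrier G" using pq(1) ab(1) by simp
  have "g = ?k \<otimes>\<^bsub>G\<^esub> \<iota> (p \<otimes>\<^bsub>S\<^esub> b)"
    by (rule trans[OF ab(3) cancel[OF ab(1,2) pq(1)]])
  moreover have "h = ?k \<otimes>\<^bsub>G\<^esub> \<iota> (q \<otimes>\<^bsub>S\<^esub> d)"
    unfolding pq(3) by (rule trans[OF cd(3) cancel[OF cd(1,2) pq(2)]])
  ultimately show "\<exists>k\<in>carrier G. (g, k) \<in> r \<and> (h, k) \<in> r"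
    unfolding preorder_iff using k gh S.m_closed[OF pq(1) ab(2)] S.m_closed[OF pq(2) cd(2)] by blast
qed

lemma ore_transition_eq:
  assumes "s \<in> carrier S" "h \<in> carrier G"
  shows "ore_transition S G \<iota> A \<Lambda> (h \<otimes>\<^bsub>G\<^esub> \<iota> s) h = reduced_action S A \<Lambda> s"
proof -
  have "inv\<^bsub>G\<^esub> h \<otimes>\<^bsub>G\<^esub> (h \<otimes>\<^bsub>G\<^esub> \<iota> s) = \<iota> s" using assms by (simp add: G.m_assoc[symmetric])
  then show ?thesis using assms by (simp add: ore_transition_def inv_into_f_f[OF emb_inj])
qed

sublocale lim: direct_system "carrier G" r "\<lambda>_. Q" "ore_transition S G \<iota> A \<Lambda>"
proof (rule direct_system.intro)
  show "directed_preorder (carrier G) r" by (rule directed_preorder_fractions)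
  show "comm_group Q" by (rule comm_group_reduced)
  show "ore_transition S G \<iota> A \<Lambda> g h \<in> hom Q Q" if "(g, h) \<in> r" for g h
    using that by (auto simp: preorder_iff ore_transition_eq reduced_action_hom)
  show "ore_transition S G \<iota> A \<Lambda> g g C = C" if "g \<in> carrier G" "C \<in> carrier Q" for g C
    using that ore_transition_eq[of "\<one>\<^bsub>S\<^esub>" g]
    by (auto simp: emb_one carrier_reduced reduced_action_coset act_unit)
  fix g h k C assume "(g, h) \<in> r" "(h, k) \<in> r" and C: "C \<in> carrier Q"
  then obtain s t where st: "g = h \<otimes>\<^bsub>G\<^esub> \<iota> s" "h = k \<otimes>\<^bsub>G\<^esub> \<iota> t" "s \<in> carrier S" "t \<in> carrier S"
    "k \<in> carrier G" "h \<in> carrier G" by (auto simp: preorder_iff)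
  \<comment> \<open>Two upward steps along \<open>s\<close> and then \<open>t\<close> make one step
    along the product \<open>t s\<close>, in which \<open>s\<close> acts first, as a left action
    requires.\<close>
  have gk: "g = k \<otimes>\<^bsub>G\<^esub> \<iota> (t \<otimes>\<^bsub>S\<^esub> s)" unfolding st(1,2) using st by (simp add: emb_mult G.m_assoc)
  have "ore_transition S G \<iota> A \<Lambda> g h = reduced_action S A \<Lambda> s"
    unfolding st(1) by (rule ore_transition_eq[OF st(3,6)])
  moreover have "ore_transition S G \<iota> A \<Lambda> h k = reduced_action S A \<Lambda> t"
    unfolding st(2) by (rule ore_transition_eq[OF st(4,5)])
  moreover have "ore_transition S G \<iota> A \<Lambda> g k = reduced_action S A \<Lambda> (t \<otimes>\<^bsub>S\<^esub> s)"
    unfolding gk using st by (intro ore_transition_eq) auto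
  ultimately show "ore_transition S G \<iota> A \<Lambda> h k (ore_transition S G \<iota> A \<Lambda> g h C) =
      ore_transition S G \<iota> A \<Lambda> g k C"
    using C st by (auto simp: carrier_reduced reduced_action_coset act_mult)
qed

section \<open>Elements of the localization as fractions\<close>

lemma comm_group_ore: "comm_group L"
  unfolding ore_group_def by (rule lim.comm_group_dirlim)

text \<open>This element plays the role of \<open>g\<close> applied to the image of
  \<open>x\<close>; at the identity of \<open>G\<close> it is the canonical map from
  \<open>A\<close> to its localization.\<close>

definition fraction :: "'g \<Rightarrow> 'a \<Rightarrow> ('g \<times> 'a set) set" where
  "fraction g x = ore_map S G \<iota> A \<Lambda> g (N #>\<^bsub>A\<^esub> x)"

lemma coset_closed: "x \<in> carrier A \<Longrightarrow> N #>\<^bsub>A\<^esub> x \<in> carrier Q"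
  by (auto simp: carrier_reduced)

lemma fraction_hom: "g \<in> carrier G \<Longrightarrow> fraction g \<in> hom A L"
  using hom_compose[OF coset_hom lim.map_hom, of g]
  by (simp add: fraction_def[abs_def] ore_map_def ore_group_def o_def)

lemma fraction_closed: "g \<in> carrier G \<Longrightarrow> x \<in> carrier A \<Longrightarrow> fraction g x \<in> carrier L"
  by (rule hom_in_carrier[OF fraction_hom])

lemma carrier_ore: "carrier L = (\<Union>g\<in>carrier G. fraction g ` carrier A)"
  by (simp add: ore_group_cover carrier_reduced image_image fraction_def)

lemma ore_action_fraction: "g \<in> carrier G \<Longrightarrow> h \<in> carrier G \<Longrightarrow>
    ore_action G g (fraction h x) = fraction (g \<otimes>\<^bsub>G\<^esub> h) x"
  unfolding fraction_def by (rule ore_action_ore_map[OF G.group_axioms])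

text \<open>This is the identification made by the transition map from \<open>g s\<close> down to
  the smaller denominator \<open>g\<close>; it makes the canonical map equivariant along
  \<iota>.\<close>

lemma fraction_mult:
  assumes "g \<in> carrier G" "s \<in> carrier S" "x \<in> carrier A"
  shows "fraction (g \<otimes>\<^bsub>G\<^esub> \<iota> s) x = fraction g (\<Lambda> s x)"
proof -
  have "(g \<otimes>\<^bsub>G\<^esub> \<iota> s, g) \<in> r" using assms by (auto simp: preorder_iff)
  from lim.map_trans[OF this coset_closed[OF assms(3)]] show ?thesis
    using assms by (simp add: fraction_def ore_map_def ore_transition_eq reduced_action_coset)
qed

text \<open>Equal classes agree at some index \<open>k\<close> with \<open>g = k t\<close>, that is,
  the images under \<open>t\<close> have equal cosets. Some \<open>s\<close> identifies those images
  by \<open>coset_eqD\<close>, and so \<open>s t\<close> identifies \<open>x\<close> and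
  \<open>y\<close>.\<close>

lemma fraction_eqD:
  assumes g: "g \<in> carrier G" and x: "x \<in> carrier A" and y: "y \<in> carrier A"
    and eq: "fraction g x = fraction g y"
  obtains s where "s \<in> carrier S" "\<Lambda> s x = \<Lambda> s y"
proof -
  obtain k where k: "(g, k) \<in> r"
    and tr: "ore_transition S G \<iota> A \<Lambda> g k (N #>\<^bsub>A\<^esub> x) = ore_transition S G \<iota> A \<Lambda> g k (N #>\<^bsub>A\<^esub> y)"
    using eq lim.map_eq_iff[OF g coset_closed[OF x] g coset_closed[OF y]]
    by (auto simp: fraction_def ore_map_def)
  obtain t where t: "t \<in> carrier S" "g = k \<otimes>\<^bsub>G\<^esub> \<iota> t" "k \<in> carrier G" using k by (auto simp: preorder_iff)
  have "N #>\<^bsub>A\<^esub> \<Lambda> t x = N #>\<^bsub>A\<^esub> \<Lambda> t y"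
    using tr t x y by (simp add: ore_transition_eq reduced_action_coset)
  then obtain s where s: "s \<in> carrier S" "\<Lambda> s (\<Lambda> t x) = \<Lambda> s (\<Lambda> t y)"
    using t x y by (elim coset_eqD[rotated 2]) auto
  then show thesis using that[of "s \<otimes>\<^bsub>S\<^esub> t"] t x y by (simp add: act_mult)
qed

lemma left_action_ore: "left_action G L (ore_action G)"
  unfolding left_action_def
proof (intro conjI ballI)
  fix g assume g: "g \<in> carrier G"
  show "ore_action G g \<in> hom L L"
  proof (rule homI)
    show "ore_action G g P \<in> carrier L" if "P \<in> carrier L" for P
    proof -
      obtain h x where "h \<in> carrier G" "x \<in> carrier A" "P = fraction h x"
        using \<open>P \<in> carrier L\<close> by (auto simp: carrier_ore)
      then show ?thesis using g by (simp add: ore_action_fraction fraction_closed)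
    qed
    fix P P' assume P: "P \<in> carrier L" "P' \<in> carrier L"
    \<comment> \<open>Additivity is checked on representatives with the same index, where it reduces
      to \<open>fraction_hom\<close>.\<close>
    then obtain h C C' where h: "h \<in> carrier G" "C \<in> carrier Q" "C' \<in> carrier Q"
      "P = lim.D h C" "P' = lim.D h C'"
      unfolding ore_group_def by (rule lim.common_index)
    then obtain x y where xy: "x \<in> carrier A" "y \<in> carrier A" "P = fraction h x" "P' = fraction h y"
      by (auto simp: carrier_reduced fraction_def ore_map_def)
    then show "ore_action G g (P \<otimes>\<^bsub>L\<^esub> P') = ore_action G g P \<otimes>\<^bsub>L\<^esub> ore_action G g P'"
      using g h(1)
      by (simp add: ore_action_fraction hom_mult[OF fraction_hom, symmetric])
  qed
next
  show "ore_action G \<one>\<^bsub>G\<^esub> P = P" if "P \<in> carrier L" for P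
    using that by (auto simp: carrier_ore ore_action_fraction)
  show "ore_action G (g \<otimes>\<^bsub>G\<^esub> h) P = ore_action G g (ore_action G h P)"
    if "g \<in> carrier G" "h \<in> carrier G" "P \<in> carrier L" for g h P
    using that by (auto simp: carrier_ore ore_action_fraction G.m_assoc)
qed

section \<open>Finite subsets of the localization and their entropy\<close>

lemma finite_subset_ore:
  assumes "finite E'" and "E' \<subseteq> carrier L"
  shows "\<exists>g\<in>carrier G. \<exists>E. finite E \<and> E \<subseteq> carrier A \<and> E' = fraction g ` E"
  using assms
proof (induction E' rule: finite_induct)
  case empty
  then show ?case by (intro bexI[of _ "\<one>\<^bsub>G\<^esub>"] exI[of _ "{}"]) auto
next
  case (insert P E')
  then obtain g E where E: "g \<in> carrier G" "finite E" "E \<subseteq> carrier A" "E' = fraction g ` E" by auto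
  obtain h x where x: "h \<in> carrier G" "x \<in> carrier A" "P = fraction h x"
    using insert.prems by (auto simp: carrier_ore)
  \<comment> \<open>Pass to a common index \<open>k\<close>; by \<open>fraction_mult\<close> the old
    points and the new one become fractions over \<open>k\<close>.\<close>
  obtain k where k: "k \<in> carrier G" "(g, k) \<in> r" "(h, k) \<in> r"
    by (rule lim.upper_bound[OF E(1) x(1)])
  then obtain s t where st: "s \<in> carrier S" "t \<in> carrier S" "g = k \<otimes>\<^bsub>G\<^esub> \<iota> s" "h = k \<otimes>\<^bsub>G\<^esub> \<iota> t"
    by (auto simp: preorder_iff)
  have "fraction g y = fraction k (\<Lambda> s y)" if "y \<in> E" for y
    using that E k st by (auto simp: fraction_mult)
  then have "E' = fraction k ` \<Lambda> s ` E" unfolding E(4) image_image by (rule image_cong[OF refl])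
  moreover have "P = fraction k (\<Lambda> t x)" using x k st by (simp add: fraction_mult)
  ultimately have "insert P E' = fraction k ` insert (\<Lambda> t x) (\<Lambda> s ` E)" by simp
  moreover have "finite (insert (\<Lambda> t x) (\<Lambda> s ` E))" "insert (\<Lambda> t x) (\<Lambda> s ` E) \<subseteq> carrier A"
    using E x st by auto
  ultimately show ?case using k(1) by blast
qed

text \<open>A left multiple of an element that identifies a pair still identifies it, and any two
  elements of \<open>S\<close> have a common left multiple. Hence one \<open>s\<close> handles all
  of the finitely many pairs of \<open>T\<close> that the localization identifies.\<close>

lemma common_separator:
  assumes g: "g \<in> carrier G" and T: "finite T" "T \<subseteq> carrier A"
  obtains s where "s \<in> carrier S"
    and "\<And>x y. x \<in> T \<Longrightarrow> y \<in> T \<Longrightarrow> fraction g x = fraction g y \<Longrightarrow> \<Lambda> s x = \<Lambda> s y"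
proof -
  have "\<exists>s\<in>carrier S. \<forall>p\<in>Z. \<Lambda> s (fst p) = \<Lambda> s (snd p)"
    if "finite Z" and "\<forall>p\<in>Z. fst p \<in> carrier A \<and> snd p \<in> carrier A \<and> fraction g (fst p) = fraction g (snd p)"
    for Z
    using that
  proof (induction Z rule: finite_induct)
    case empty
    then show ?case by (intro bexI[of _ "\<one>\<^bsub>S\<^esub>"]) simp_all
  next
    case (insert z Z)
    have z: "fst z \<in> carrier A" "snd z \<in> carrier A" "fraction g (fst z) = fraction g (snd z)"
      and Z: "\<And>p. p \<in> Z \<Longrightarrow> fst p \<in> carrier A \<and> snd p \<in> carrier A"
      using insert.prems by blast+
    obtain s where s: "s \<in> carrier S" "\<forall>p\<in>Z. \<Lambda> s (fst p) = \<Lambda> s (snd p)"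
      using insert.IH insert.prems by blast
    obtain t where t: "t \<in> carrier S" "\<Lambda> t (fst z) = \<Lambda> t (snd z)"
      by (rule fraction_eqD[OF g z])
    obtain a b where ab: "a \<in> carrier S" "b \<in> carrier S" "a \<otimes>\<^bsub>S\<^esub> s = b \<otimes>\<^bsub>S\<^esub> t"
      by (rule left_ore[OF s(1) t(1)])
    have "\<Lambda> (a \<otimes>\<^bsub>S\<^esub> s) (fst p) = \<Lambda> (a \<otimes>\<^bsub>S\<^esub> s) (snd p)" if "p \<in> Z" for p
      using bspec[OF s(2) that] s(1) ab(1) Z[OF that] by (simp add: act_mult)
    moreover have "\<Lambda> (a \<otimes>\<^bsub>S\<^esub> s) (fst z) = \<Lambda> (a \<otimes>\<^bsub>S\<^esub> s) (snd z)"
      unfolding ab(3) using t ab(2) z(1,2) by (simp add: act_mult)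
    moreover have "a \<otimes>\<^bsub>S\<^esub> s \<in> carrier S" using ab(1) s(1) by (rule S.m_closed)
    ultimately show ?case by blast
  qed
  from this[of "{p \<in> T \<times> T. fraction g (fst p) = fraction g (snd p)}"]
  obtain s where s: "s \<in> carrier S"
    and sep: "\<forall>p\<in>{p \<in> T \<times> T. fraction g (fst p) = fraction g (snd p)}. \<Lambda> s (fst p) = \<Lambda> s (snd p)"
    using T by fastforce
  show thesis
  proof (rule that[OF s])
    fix x y assume "x \<in> T" "y \<in> T" "fraction g x = fraction g y"
    then show "\<Lambda> s x = \<Lambda> s y" using bspec[OF sep, of "(x, y)"] by simp
  qed
qed

text \<open>Let \<open>s\<close> and \<open>t\<close> be the denominator and numerator of
  \<open>g\<close>. If \<open>f = f' s\<close> with \<open>f'\<close> in \<open>F i\<close>, then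
  \<open>f g = f' t\<close>, which leaves \<open>F i\<close> only within the defect of
  \<open>t\<close>. The other \<open>f\<close> are as many as the defect of \<open>s\<close>, by
  \<open>card_Diff_right_translate\<close>. So the defect of \<open>g\<close> is at most the sum of
  the two.\<close>

lemma right_folner_net_fractions:
  assumes N: "right_folner_net S I R F"
  shows "right_folner_net G I R (\<lambda>i. \<iota> ` F i)"
  unfolding right_folner_net_def
proof (intro conjI ballI)
  have F: "F i \<subseteq> carrier S" "finite (F i)" "F i \<noteq> {}" if "i \<in> I" for i
    using N that by (auto simp: right_folner_net_def)
  show D: "directed_preorder I R" using N by (simp add: right_folner_net_def)
  show "finite (\<iota> ` F i)" "\<iota> ` F i \<noteq> {}" "\<iota> ` F i \<subseteq> carrier G" if "i \<in> I" for i
    using F[OF that] by auto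
  fix g assume "g \<in> carrier G"
  then obtain s t where st: "s \<in> carrier S" "t \<in> carrier S" "g = inv\<^bsub>G\<^esub> \<iota> s \<otimes>\<^bsub>G\<^esub> \<iota> t"
    by (rule fractionE)
  define b where "b u i = real (card ((\<lambda>f. f \<otimes>\<^bsub>S\<^esub> u) ` F i - F i)) / real (card (F i))" for u i
  have lim: "((\<lambda>i. b s i + b t i) \<longlongrightarrow> 0 + 0) (tails I R)"
    unfolding b_def using N st by (intro tendsto_add) (auto simp: right_folner_net_def)
  show "((\<lambda>i. real (card ((\<lambda>f. f \<otimes>\<^bsub>G\<^esub> g) ` \<iota> ` F i - \<iota> ` F i)) / real (card (\<iota> ` F i))) \<longlongrightarrow> 0) (tails I R)"
  proof (rule tendsto_sandwich[of "\<lambda>_. 0"])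
    show "eventually (\<lambda>i. real (card ((\<lambda>f. f \<otimes>\<^bsub>G\<^esub> g) ` \<iota> ` F i - \<iota> ` F i)) / real (card (\<iota> ` F i))
        \<le> b s i + b t i) (tails I R)"
      unfolding eventually_tails[OF D]
    proof -
      have "real (card ((\<lambda>f. f \<otimes>\<^bsub>G\<^esub> g) ` \<iota> ` F i - \<iota> ` F i)) / real (card (\<iota> ` F i)) \<le> b s i + b t i"
        if i: "i \<in> I" for i
      proof -
        let ?s = "\<lambda>f. f \<otimes>\<^bsub>S\<^esub> s" and ?t = "\<lambda>f. f \<otimes>\<^bsub>S\<^esub> t"
        have "(\<lambda>f. f \<otimes>\<^bsub>G\<^esub> g) ` \<iota> ` F i - \<iota> ` F i \<subseteq>
          (\<lambda>f. \<iota> f \<otimes>\<^bsub>G\<^esub> g) ` (F i - ?s ` F i) \<union> \<iota> ` (?t ` F i - F i)"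
        proof
          fix x assume x: "x \<in> (\<lambda>f. f \<otimes>\<^bsub>G\<^esub> g) ` \<iota> ` F i - \<iota> ` F i"
          then obtain f where f: "f \<in> F i" "x = \<iota> f \<otimes>\<^bsub>G\<^esub> g" by auto
          show "x \<in> (\<lambda>f. \<iota> f \<otimes>\<^bsub>G\<^esub> g) ` (F i - ?s ` F i) \<union> \<iota> ` (?t ` F i - F i)"
          proof (cases "f \<in> ?s ` F i")
            case True
            then obtain f' where f': "f' \<in> F i" "f = f' \<otimes>\<^bsub>S\<^esub> s" by auto
            have c: "f' \<in> carrier S" using F(1)[OF i] f' by auto
            have "\<iota> s \<otimes>\<^bsub>G\<^esub> (inv\<^bsub>G\<^esub> \<iota> s \<otimes>\<^bsub>G\<^esub> \<iota> t) = \<iota> t"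
              using st by (simp add: G.m_assoc[symmetric])
            then have "x = \<iota> (f' \<otimes>\<^bsub>S\<^esub> t)"
              unfolding f f' st(3) using c st(1,2) by (simp add: emb_mult G.m_assoc)
            then show ?thesis using x f' by blast
          qed (use f in blast)
        qed
        then have "card ((\<lambda>f. f \<otimes>\<^bsub>G\<^esub> g) ` \<iota> ` F i - \<iota> ` F i) \<le>
            card ((\<lambda>f. \<iota> f \<otimes>\<^bsub>G\<^esub> g) ` (F i - ?s ` F i) \<union> \<iota> ` (?t ` F i - F i))"
          using F(2)[OF i] by (intro card_mono) auto
        also have "\<dots> \<le> card ((\<lambda>f. \<iota> f \<otimes>\<^bsub>G\<^esub> g) ` (F i - ?s ` F i)) + card (\<iota> ` (?t ` F i - F i))"
          by (rule card_Un_le)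
        also have "\<dots> \<le> card (F i - ?s ` F i) + card (?t ` F i - F i)"
          using F(2)[OF i] by (intro add_mono card_image_le) auto
        also have "card (F i - ?s ` F i) = card (?s ` F i - F i)"
          by (rule S.card_Diff_right_translate[OF F(1,2)[OF i] st(1)])
        finally have "real (card ((\<lambda>f. f \<otimes>\<^bsub>G\<^esub> g) ` \<iota> ` F i - \<iota> ` F i)) \<le>
            real (card (?s ` F i - F i)) + real (card (?t ` F i - F i))"
          by linarith
        moreover have "card (\<iota> ` F i) = card (F i)"
          by (rule card_image[OF inj_on_subset[OF emb_inj F(1)[OF i]]])
        ultimately show ?thesis
          unfolding b_def add_divide_distrib[symmetric] by (simp add: divide_right_mono)
      qed
      then show "\<exists>i\<in>I. \<forall>j\<in>I. (i, j) \<in> R \<longrightarrow>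
          real (card ((\<lambda>f. f \<otimes>\<^bsub>G\<^esub> g) ` \<iota> ` F j - \<iota> ` F j)) / real (card (\<iota> ` F j)) \<le> b s j + b t j"
        using D by (auto simp: directed_preorder_def)
    qed
  qed (use lim in simp_all)
qed

lemma H_alg_fraction:
  assumes am: "right_amenable S" and E: "finite E" "E \<subseteq> carrier A" "\<one>\<^bsub>A\<^esub> \<in> E"
  shows "H_alg G L (ore_action G) (fraction \<one>\<^bsub>G\<^esub> ` E) = H_alg S A \<Lambda> E"
proof -
  define \<pi> where "\<pi> = fraction \<one>\<^bsub>G\<^esub>"
  interpret L: comm_group L by (rule comm_group_ore)
  have \<pi>: "\<pi> \<in> hom A L" unfolding \<pi>_def by (rule fraction_hom) simp
  interpret X: action_on_finite_set S A \<Lambda> E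
    by unfold_locales (use act E in auto)
  have cancelG: "monoid_cancel G" by (rule G.is_monoid_cancel)
  interpret Y: action_on_finite_set G L "ore_action G" "\<pi> ` E"
  proof (intro action_on_finite_set.intro cancelG L.comm_group_axioms action_on_finite_set_axioms.intro
      left_action_ore finite_imageI E)
    show "\<pi> ` E \<subseteq> carrier L" using E hom_in_carrier[OF \<pi>] by auto
    show "\<one>\<^bsub>L\<^esub> \<in> \<pi> ` E" using E hom_one[OF \<pi> A.group_axioms L.group_axioms] by force
  qed
  have traj: "trajectory L (ore_action G) (\<iota> ` K) (\<pi> ` E) = \<pi> ` trajectory A \<Lambda> K E"
    if K: "K \<subseteq> carrier S" for K
  proof (rule trajectory_equivariant[OF A.comm_group_axioms L.comm_group_axioms \<pi>])
    show "inj_on \<iota> K" by (rule inj_on_subset[OF emb_inj K])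
    show "\<Lambda> s x \<in> carrier A" if "s \<in> K" "x \<in> E" for s x
      by (rule X.act_E[OF K that])
    show "ore_action G (\<iota> s) (\<pi> x) = \<pi> (\<Lambda> s x)" if "s \<in> K" "x \<in> E" for s x
    proof -
      have "s \<in> carrier S" "x \<in> carrier A" using that K E by auto
      then show ?thesis
        using fraction_mult[of "\<one>\<^bsub>G\<^esub>" s x] by (simp add: \<pi>_def ore_action_fraction)
    qed
  qed
  have card\<iota>: "card (\<iota> ` K) = card K" if "K \<subseteq> carrier S" for K
    by (rule card_image[OF inj_on_subset[OF emb_inj that]])
  obtain I :: "'s net_index set" and R F where N: "right_folner_net S I R F"
    using am unfolding right_amenable_def by blast
  have NG: "right_folner_net G I R (\<lambda>i. \<iota> ` F i)" by (rule right_folner_net_fractions[OF N])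
  have F: "F i \<subseteq> carrier S" "finite (F i)" "F i \<noteq> {}" if "i \<in> I" for i
    using N that by (auto simp: right_folner_net_def)
  have D: "directed_preorder I R" using N by (simp add: right_folner_net_def)
  \<comment> \<open>Each index set of \<open>S\<close> also competes in the infimum for
    \<open>G\<close>, and there its trajectory is an image under \<pi>, hence no larger.\<close>
  have "Y.rate \<le> X.rate"
  proof (rule X.rate_greatest)
    fix K assume K: "K \<subseteq> carrier S" "finite K" "K \<noteq> {}"
    have "Y.rate \<le> Y.log_size (\<iota> ` K) / real (card (\<iota> ` K))"
      using K by (intro Y.rate_le) auto
    also have "Y.log_size (\<iota> ` K) \<le> X.log_size K"
    proof -
      have "card (\<pi> ` trajectory A \<Lambda> K E) \<le> card (trajectory A \<Lambda> K E)"
        by (rule card_image_le[OF X.finite_trajectory[OF K(1,2)]])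
      moreover have "1 \<le> card (\<pi> ` trajectory A \<Lambda> K E)"
        unfolding traj[OF K(1), symmetric] using K by (intro Y.card_trajectory_ge_1) auto
      ultimately show ?thesis unfolding Y.log_size_def X.log_size_def traj[OF K(1)]
        by (intro ln_mono) simp_all
    qed
    finally show "Y.rate \<le> X.log_size K / real (card K)"
      by (simp add: card\<iota>[OF K(1)] divide_right_mono)
  qed
  \<comment> \<open>Index sets in \<open>G\<close> need not come from \<open>S\<close>, so the bound
    is proved only for images of index sets of \<open>S\<close>. That is enough, because
    \<open>Y.rate\<close> is also the limit along the image of a Foelner net of
    \<open>S\<close>.\<close>
  moreover have "X.rate \<le> Y.rate"
  proof (rule tendsto_lowerbound[OF Y.tendsto_rate[OF NG]])
    have "X.rate \<le> Y.log_size (\<iota> ` K) / real (card (\<iota> ` K))"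
      if K: "K \<subseteq> carrier S" "finite K" "K \<noteq> {}" for K
    proof -
      obtain s where s: "s \<in> carrier S"
        and sep: "\<And>x y. x \<in> trajectory A \<Lambda> K E \<Longrightarrow> y \<in> trajectory A \<Lambda> K E \<Longrightarrow> \<pi> x = \<pi> y \<Longrightarrow> \<Lambda> s x = \<Lambda> s y"
        using common_separator[OF G.one_closed X.finite_trajectory[OF K(1,2)] X.trajectory_closed[OF K(1)]]
        unfolding \<pi>_def by metis
      let ?sK = "(\<lambda>k. s \<otimes>\<^bsub>S\<^esub> k) ` K"
      have sK: "?sK \<subseteq> carrier S" "finite ?sK" "?sK \<noteq> {}" using K s by auto
      \<comment> \<open>By the choice of \<open>s\<close>, the map \<open>\<Lambda> s\<close>
        factors through \<pi> on this trajectory, so its image is no larger than that of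
        \<pi>.\<close>
      have "card (\<Lambda> s ` trajectory A \<Lambda> K E) \<le> card (\<pi> ` trajectory A \<Lambda> K E)"
      proof (rule surj_card_le)
        show "finite (\<pi> ` trajectory A \<Lambda> K E)" using X.finite_trajectory[OF K(1,2)] by simp
        show "\<Lambda> s ` trajectory A \<Lambda> K E \<subseteq>
            (\<lambda>p. \<Lambda> s (inv_into (trajectory A \<Lambda> K E) \<pi> p)) ` \<pi> ` trajectory A \<Lambda> K E"
        proof clarify
          fix x assume x: "x \<in> trajectory A \<Lambda> K E"
          then have "\<Lambda> s x = \<Lambda> s (inv_into (trajectory A \<Lambda> K E) \<pi> (\<pi> x))"
            by (intro sep) (auto intro: inv_into_into simp: f_inv_into_f)
          then show "\<Lambda> s x \<in> (\<lambda>p. \<Lambda> s (inv_into (trajectory A \<Lambda> K E) \<pi> p)) ` \<pi> ` trajectory A \<Lambda> K E"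
            using x by blast
        qed
      qed
      then have "X.log_size ?sK \<le> Y.log_size (\<iota> ` K)"
        unfolding X.log_size_def Y.log_size_def X.trajectory_translate[OF K(1) s] traj[OF K(1)]
        using X.card_trajectory_ge_1[OF sK(1,2)] unfolding X.trajectory_translate[OF K(1) s]
        by (intro ln_mono) simp_all
      then have "X.log_size ?sK / real (card K) \<le> Y.log_size (\<iota> ` K) / real (card K)"
        by (rule divide_right_mono) simp
      moreover have "card ?sK = card K"
        using K s by (intro card_image inj_onI) (auto dest: S.l_cancel)
      moreover have "X.rate \<le> X.log_size ?sK / real (card ?sK)" using sK by (rule X.rate_le)
      ultimately show ?thesis by (simp add: card\<iota>[OF K(1)])
    qed
    then show "eventually (\<lambda>i. X.rate \<le> Y.log_size (\<iota> ` F i) / real (card (\<iota> ` F i))) (tails I R)"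
      unfolding eventually_tails[OF D] using F D by (auto simp: directed_preorder_def)
    show "tails I R \<noteq> bot" by (rule tails_neq_bot[OF D])
  qed
  ultimately have "X.rate = Y.rate" by simp
  then show ?thesis
    using X.H_alg_eq_rate[OF am] Y.H_alg_eq_rate[OF right_amenableI[OF NG]] by (simp add: \<pi>_def)
qed

end

section \<open>Invariance under the localization\<close>

text \<open>The trajectory of the moved set over \<open>K\<close> is that of \<open>E\<close> over
  \<open>K g\<close>, an index set of the same size that competes in the infimum for
  \<open>E\<close>.\<close>

lemma H_alg_group_translate_le:
  assumes "group G" and "right_amenable G" and "comm_group A" and act: "left_action G A \<alpha>"
    and E: "finite E" "E \<subseteq> carrier A" "\<one>\<^bsub>A\<^esub> \<in> E" and g: "g \<in> carrier G"
  shows "H_alg G A \<alpha> E \<le> H_alg G A \<alpha> (\<alpha> g ` E)"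
proof -
  interpret G: group G by fact
  interpret A: comm_group A by fact
  interpret P: action_on_finite_set G A \<alpha> E
    by (intro action_on_finite_set.intro G.is_monoid_cancel A.comm_group_axioms
        action_on_finite_set_axioms.intro act E)
  interpret Q: action_on_finite_set G A \<alpha> "\<alpha> g ` E"
  proof (intro action_on_finite_set.intro G.is_monoid_cancel A.comm_group_axioms
        action_on_finite_set_axioms.intro act finite_imageI E)
    show "\<alpha> g ` E \<subseteq> carrier A" using g E by auto
    show "\<one>\<^bsub>A\<^esub> \<in> \<alpha> g ` E" using g E by (metis P.act_one imageI)
  qed
  have "P.rate \<le> Q.rate"
  proof (rule Q.rate_greatest)
    fix K assume K: "K \<subseteq> carrier G" "finite K" "K \<noteq> {}"
    let ?Kg = "(\<lambda>k. k \<otimes>\<^bsub>G\<^esub> g) ` K"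
    have inj: "inj_on (\<lambda>k. k \<otimes>\<^bsub>G\<^esub> g) K"
      using K g by (auto intro!: inj_onI dest: G.r_cancel)
    \<comment> \<open>The transport starts from \<open>K g\<close> and multiplies back by the
      inverse of \<open>g\<close>, matching the motion of \<open>E\<close> by
      \<open>g\<close>.\<close>
    have "trajectory A \<alpha> ((\<lambda>k. k \<otimes>\<^bsub>G\<^esub> inv\<^bsub>G\<^esub> g) ` ?Kg) (\<alpha> g ` E) =
        (\<lambda>x. x) ` trajectory A \<alpha> ?Kg E"
    proof (rule trajectory_equivariant[OF A.comm_group_axioms A.comm_group_axioms])
      show "(\<lambda>x. x) \<in> hom A A" by (rule homI) auto
      show "inj_on (\<lambda>k. k \<otimes>\<^bsub>G\<^esub> inv\<^bsub>G\<^esub> g) ?Kg"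
        using K g G.r_cancel[OF _ _ _ G.inv_closed[OF g]] by (intro inj_onI) blast
      show "\<alpha> k x \<in> carrier A" if "k \<in> ?Kg" "x \<in> E" for k x
        using that K g E by (intro P.act_closed) auto
      show "\<alpha> (k \<otimes>\<^bsub>G\<^esub> inv\<^bsub>G\<^esub> g) (\<alpha> g x) = \<alpha> k x" if "k \<in> ?Kg" "x \<in> E" for k x
      proof -
        have c: "k \<in> carrier G" "x \<in> carrier A" using that K g E by auto
        then have "\<alpha> (k \<otimes>\<^bsub>G\<^esub> inv\<^bsub>G\<^esub> g) (\<alpha> g x) = \<alpha> (k \<otimes>\<^bsub>G\<^esub> inv\<^bsub>G\<^esub> g \<otimes>\<^bsub>G\<^esub> g) x"
          using g by (intro P.act_mult[symmetric]) auto
        then show ?thesis using c g by (simp add: G.m_assoc)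
      qed
    qed
    moreover have "(\<lambda>k. k \<otimes>\<^bsub>G\<^esub> inv\<^bsub>G\<^esub> g) ` ?Kg = (\<lambda>k. k) ` K"
      unfolding image_image using K g by (intro image_cong refl) (auto simp: G.m_assoc dest: subsetD)
    ultimately have "trajectory A \<alpha> K (\<alpha> g ` E) = trajectory A \<alpha> ?Kg E" by simp
    then have "Q.log_size K / real (card K) = P.log_size ?Kg / real (card ?Kg)"
      by (simp add: Q.log_size_def P.log_size_def card_image[OF inj])
    moreover have "P.rate \<le> P.log_size ?Kg / real (card ?Kg)"
      using K g by (intro P.rate_le) auto
    ultimately show "P.rate \<le> Q.log_size K / real (card K)" by simp
  qed
  then show ?thesis using P.H_alg_eq_rate Q.H_alg_eq_rate assms(2) by simp
qed

text \<open>The reverse inequality comes from moving the translated set back by the inverse of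
  \<open>g\<close>.\<close>

lemma H_alg_group_translate:
  assumes "group G" and "right_amenable G" and "comm_group A" and act: "left_action G A \<alpha>"
    and E: "finite E" "E \<subseteq> carrier A" "\<one>\<^bsub>A\<^esub> \<in> E" and g: "g \<in> carrier G"
  shows "H_alg G A \<alpha> (\<alpha> g ` E) = H_alg G A \<alpha> E"
proof (rule antisym)
  interpret G: group G by fact
  interpret A: comm_group A by fact
  interpret P: action_on_finite_set G A \<alpha> E
    by (intro action_on_finite_set.intro G.is_monoid_cancel A.comm_group_axioms
        action_on_finite_set_axioms.intro act E)
  have gE: "finite (\<alpha> g ` E)" "\<alpha> g ` E \<subseteq> carrier A" "\<one>\<^bsub>A\<^esub> \<in> \<alpha> g ` E"
    using g E P.act_one[OF g] by (auto intro: rev_image_eqI)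
  have "\<alpha> (inv\<^bsub>G\<^esub> g) (\<alpha> g x) = x" if "x \<in> E" for x
    using that E g act P.act_mult[of "inv\<^bsub>G\<^esub> g" g x] by (auto simp: left_action_def)
  then have "\<alpha> (inv\<^bsub>G\<^esub> g) ` \<alpha> g ` E = E" unfolding image_image by simp
  then show "H_alg G A \<alpha> (\<alpha> g ` E) \<le> H_alg G A \<alpha> E"
    using H_alg_group_translate_le[OF assms(1-4) gE G.inv_closed[OF g]] by simp
  show "H_alg G A \<alpha> E \<le> H_alg G A \<alpha> (\<alpha> g ` E)"
    by (rule H_alg_group_translate_le[OF assms])
qed

theorem theorem2p9:
  fixes S :: "'s monoid" and G :: "'g monoid" and \<iota> :: "'s \<Rightarrow> 'g"
    and A :: "'a monoid" and \<Lambda> :: "'s \<Rightarrow> 'a \<Rightarrow> 'a"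
  assumes "monoid_cancel S" and "right_amenable S"
    and "group_of_left_fractions S G \<iota>"
    and "comm_group A" and "left_action S A \<Lambda>"
  shows "h_alg S A \<Lambda> = h_alg G (ore_group S G \<iota> A \<Lambda>) (ore_action G)"
proof -
  have "group G" using assms(3) by (simp add: group_of_left_fractions_def)
  then interpret ore_localization S G \<iota> A \<Lambda>
    by (intro ore_localization.intro ore_localization_axioms.intro assms)
  interpret L: comm_group L by (rule comm_group_ore)
  \<comment> \<open>The embedded net lives over the index type of \<open>S\<close>;
    \<open>right_amenableI\<close> reindexes it for \<open>G\<close>.\<close>
  have amG: "right_amenable G"
    using assms(2) right_amenableI right_folner_net_fractions
    unfolding right_amenable_def[of S] by blast
  have one: "fraction g \<one>\<^bsub>A\<^esub> = \<one>\<^bsub>L\<^esub>" if "g \<in> carrier G" for g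
    using hom_one[OF fraction_hom[OF that] A.group_axioms L.group_axioms] .
  let ?\<pi> = "fraction \<one>\<^bsub>G\<^esub>"
  have \<pi>E: "finite (?\<pi> ` E)" "?\<pi> ` E \<subseteq> carrier L" "\<one>\<^bsub>L\<^esub> \<in> ?\<pi> ` E"
    if "finite E" "E \<subseteq> carrier A" "\<one>\<^bsub>A\<^esub> \<in> E" for E
    using that one[of "\<one>\<^bsub>G\<^esub>"] fraction_closed by (auto intro: rev_image_eqI)
  show ?thesis
    unfolding h_alg_def
  proof (rule SUP_eq)
    fix E assume "E \<in> {E. finite E \<and> E \<subseteq> carrier A \<and> \<one>\<^bsub>A\<^esub> \<in> E}"
    then have E: "finite E" "E \<subseteq> carrier A" "\<one>\<^bsub>A\<^esub> \<in> E" by auto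
    show "\<exists>E'\<in>{E. finite E \<and> E \<subseteq> carrier L \<and> \<one>\<^bsub>L\<^esub> \<in> E}.
        ereal (H_alg S A \<Lambda> E) \<le> ereal (H_alg G L (ore_action G) E')"
      using \<pi>E[OF E] H_alg_fraction[OF assms(2) E] by (intro bexI[of _ "?\<pi> ` E"]) auto
  next
    fix E' assume E': "E' \<in> {E. finite E \<and> E \<subseteq> carrier L \<and> \<one>\<^bsub>L\<^esub> \<in> E}"
    then have "finite E'" "E' \<subseteq> carrier L" by simp_all
    from finite_subset_ore[OF this]
    obtain g E0 where g: "g \<in> carrier G" and E0: "finite E0" "E0 \<subseteq> carrier A" "E' = fraction g ` E0"
      by (elim bexE exE conjE) (rule that)
    \<comment> \<open>\<open>E0\<close> may lack the neutral element. Adding it does not change the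
      image, because \<open>E'\<close> already contains the identity of the localization.\<close>
    let ?E = "insert \<one>\<^bsub>A\<^esub> E0"
    have E: "finite ?E" "?E \<subseteq> carrier A" "\<one>\<^bsub>A\<^esub> \<in> ?E" using E0 by auto
    have "E' = fraction g ` ?E" using E0(3) E' one[OF g] by auto
    \<comment> \<open>Now \<open>E'\<close> is a group translate of a set on which
      \<open>H_alg_fraction\<close> applies.\<close>
    also have "\<dots> = ore_action G g ` ?\<pi> ` ?E"
      unfolding image_image using g by (simp add: ore_action_fraction)
    finally have "H_alg G L (ore_action G) E' = H_alg S A \<Lambda> ?E"
      using H_alg_group_translate[OF G.group_axioms amG comm_group_ore left_action_ore \<pi>E[OF E] g]
        H_alg_fraction[OF assms(2) E] by simp
    then show "\<exists>E\<in>{E. finite E \<and> E \<subseteq> carrier A \<and> \<one>\<^bsub>A\<^esub> \<in> E}.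
        ereal (H_alg G L (ore_action G) E') \<le> ereal (H_alg S A \<Lambda> E)"
      using E by (intro bexI[of _ ?E]) auto
  qed
qed

end
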